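(* Let $p\in[1,2]$ and $p'\in[2,\infty]$ be such that $\frac1p+\frac1{p'}=1$. Let $\Phi\in L^p_{\mathrm{pr}}(\Omega_T\times U;H)$ be such that $\Phi=0$ $\mathbb P_T\otimes\nu$-almost everywhere on $\Omega_T\times B^c$ for some $B\in\mathcal B(U)$ (with $B^c=U\setminus B$), and let $F\in L^{p'}(\Omega;H)$ be such that $\mathbf 1_{\Omega_T\times B}DF\in L^{p'}(\Omega_T\times U;H)$. Then $$\mathbb E\Big\langle F,\int_0^T\int_U\Phi(t,x)\,\tilde N(\mathrm dt,\mathrm dx)\Big\rangle=\mathbb E\int_0^T\int_U\big\langle D_{t,x}F,\Phi(t,x)\big\rangle\,\nu(\mathrm dx)\,\mathrm dt.$$
   Context: Setting: $T\in(0,\infty)$, $U$ is a separable real Hilbert space, $\nu$ is a $\sigma$-finite measure on $(U,\mathcal B(U))$, $\lambda$ is Lebesgue measure on $[0,T]$. $\mathbf N$ is the space of all $\sigma$-finite $\mathbb N_0\cup\{+\infty\}$-valued measures on $([0,T]\times U,\mathcal B([0,T]\times U))$ with the $\sigma$-algebra generated by the evaluations $\eta\mapsto\eta(B)$. $(\Omega,\mathcal F,\mathbb P)$ is a complete probability space, $N:\Omega\to\mathbf N$ is a Poisson random measure on $[0,T]\times U$ with intensity measure $\lambda\otimes\nu$, given as a random sum of Dirac measures $N=\sum_{n=1}^{N([0,T]\times U)}\delta_{X_n}$ with random variables $X_n$ in $[0,T]\times U$; $\mathcal F$ is the $\mathbb P$-completion of $\sigma(N)$; $\tilde N:=N-\lambda\otimes\nu$.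 $H$ is a separable real Hilbert space with inner product $\langle\cdot,\cdot\rangle$, norm $\|\cdot\|$. Filtration: $\mathcal F_t:=\bigcap_{u\in(t,T]}\mathcal F_{[0,u]\times U}$ for $t<T$ and $\mathcal F_T:=\mathcal F$, where $\mathcal F_{[0,u]\times U}$ is the $\mathbb P$-completion of the $\sigma$-algebra generated by $N(([0,u]\times U)\cap B)$, $B\in\mathcal B([0,T]\times U)$. $\Omega_T:=\Omega\times[0,T]$, $\mathbb P_T:=\mathbb P\otimes\lambda$, $\mathcal P_T$ is the predictable $\sigma$-algebra of $(\mathcal F_t)$, and $L^p_{\mathrm{pr}}(\Omega_T\times U;H):=L^p(\Omega_T\times U,\mathcal P_T\otimes\mathcal B(U),\mathbb P_T\otimes\nu;H)$. Difference operator: $D:L^0(\Omega;H)\to L^0(\Omega\times([0,T]\times U);H)$, $D_{t,x}F:=f(N+\delta_{(t,x)})-f(N)$, where $f:\mathbf N\to H$ is measurable with $F=f(N)$ a.s. ($\mathbb P_T\otimes\nu$-a.e. independent of $f$); $L^0$ denotes equivalence classes of strongly measurable functions. Stochastic integral: for $p\in[1,2]$, $\Phi\mapsto\int_0^T\int_U\Phi(t,x)\,\tilde N(\mathrm dt,\mathrm dx)$ is the unique continuous linear map $L^p_{\mathrm{pr}}(\Omega_T\times U;H)\to L^p(\Omega;H)$ that sends $F\mathbf 1_{(r,s]\times B}$ to $F\,\tilde N((r,s]\times B)$ for $0\le r\le s\le T$, $F:\Omega\to H$ bounded and $\mathcal F_r$-measurable, $\nu(B)<\infty$; the maps for different $p$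 agree on the intersection of their domains. *)

theory Defs
  imports "HOL-Probability.Probability"
begin

section \<open>Point measures on \<open>[0,T] \<times> U\<close>\<close>

definition mark_space :: "real \<Rightarrow> (real \<times> 'u::topological_space) measure" where
  "mark_space T = restrict_space borel ({0..T} \<times> UNIV)"

text \<open>Lebesgue measure on \<open>[0,T]\<close> with its Borel \<open>\<sigma>\<close>-algebra.\<close>

definition leb :: "real \<Rightarrow> real measure" where
  "leb T = restrict_space lborel {0..T}"

definition point_measure_set :: "real \<Rightarrow> (real \<times> 'u::topological_space) measure set" where
  "point_measure_set T =
     {\<eta>. sets \<eta> = sets (mark_space T) \<and> sigma_finite_measure \<eta> \<and>
         (\<forall>B\<in>sets (mark_space T). emeasure \<eta> B \<in> insert \<infinity> \<nat>)}"

definition point_measures :: "real \<Rightarrow> (real \<times> 'u::topological_space) measure measure" where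
  "point_measures T = sigma (point_measure_set T)
     {{\<eta> \<in> point_measure_set T. emeasure \<eta> B \<in> A} | B A. B \<in> sets (mark_space T) \<and> A \<in> sets borel}"

text \<open>The measure \<open>\<eta> + \<delta>\<^sub>z\<close>.\<close>

definition add_dirac :: "'a measure \<Rightarrow> 'a \<Rightarrow> 'a measure" where
  "add_dirac \<eta> z = measure_of (space \<eta>) (sets \<eta>) (\<lambda>B. emeasure \<eta> B + emeasure (return \<eta> z) B)"

lemma emeasure_add_dirac:
  assumes "B \<in> sets \<eta>"
  shows "emeasure (add_dirac \<eta> z) B = emeasure \<eta> B + indicator B z"
proof -
  let ?m = "\<lambda>B. emeasure \<eta> B + emeasure (return \<eta> z) B"
  have "countably_additive (sets \<eta>) ?m"
  proof (rule countably_additiveI)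
    fix A :: "nat \<Rightarrow> 'a set"
    assume A: "range A \<subseteq> sets \<eta>" "disjoint_family A"
    have "(\<Sum>i. ?m (A i)) = (\<Sum>i. emeasure \<eta> (A i)) + (\<Sum>i. emeasure (return \<eta> z) (A i))"
      by (rule suminf_add[symmetric]) auto
    also have "\<dots> = ?m (\<Union>i. A i)"
      using suminf_emeasure[OF A] suminf_emeasure[of A "return \<eta> z"] A
      by (simp only: sets_return)
    finally show "(\<Sum>i. ?m (A i)) = ?m (\<Union>i. A i)" .
  qed
  then have "emeasure (add_dirac \<eta> z) B = ?m B"
    unfolding add_dirac_def
    by (intro emeasure_measure_of_sigma)
      (auto simp: assms positive_def sets.sigma_algebra_axioms)
  with assms show ?thesis by simp
qed

lemma sets_add_dirac [simp]: "sets (add_dirac \<eta> z) = sets \<eta>"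
  by (simp add: add_dirac_def)

lemma space_add_dirac [simp]: "space (add_dirac \<eta> z) = space \<eta>"
  by (simp add: add_dirac_def)

lemma add_dirac_in_point_measure_set:
  assumes "\<eta> \<in> point_measure_set T"
  shows "add_dirac \<eta> z \<in> point_measure_set T"
proof -
  have s: "sets \<eta> = sets (mark_space T)" and sf: "sigma_finite_measure \<eta>"
    and n: "\<And>B. B \<in> sets (mark_space T) \<Longrightarrow> emeasure \<eta> B \<in> insert \<infinity> \<nat>"
    using assms by (auto simp: point_measure_set_def)
  have "sigma_finite_measure (add_dirac \<eta> z)"
  proof -
    obtain A where A: "countable A" "A \<subseteq> sets \<eta>" "\<Union>A = space \<eta>" "\<forall>a\<in>A. emeasure \<eta> a \<noteq> \<infinity>"
      using sigma_finite_measure.sigma_finite_countable[OF sf] by auto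
    have "\<forall>a\<in>A. emeasure (add_dirac \<eta> z) a \<noteq> \<infinity>"
      using A by (auto simp: emeasure_add_dirac subset_iff indicator_def)
    then show ?thesis
      using A by (intro sigma_finite_measure.intro exI[of _ A]) auto
  qed
  moreover have "emeasure (add_dirac \<eta> z) B \<in> insert \<infinity> \<nat>" if B: "B \<in> sets (mark_space T)" for B
  proof -
    have "indicator B z \<in> (\<nat> :: ennreal set)"
      by (auto simp: indicator_def)
    with n[OF B] show ?thesis
      using B s by (auto simp: emeasure_add_dirac intro: Nats_add)
  qed
  ultimately show ?thesis
    using s by (auto simp: point_measure_set_def)
qed


section \<open>Poisson random measures\<close>

lemma sets_leb_pair:
  fixes \<nu> :: "'u::second_countable_topology measure"
  assumes "sets \<nu> = sets borel"
  shows "sets (leb T \<Otimes>\<^sub>M \<nu>) = sets (mark_space T)"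
proof -
  have sp: "space (leb T \<Otimes>\<^sub>M \<nu>) = {0..T} \<times> UNIV"
    using sets_eq_imp_space_eq[OF assms]
    by (simp add: space_pair_measure leb_def space_restrict_space)
  have R: "{0..T} \<times> (UNIV::'u set) \<in> sets borel"
    by (intro borel_closed closed_Times) auto
  show ?thesis
  proof
    have "X \<times> Y \<in> sets (mark_space T)" if X: "X \<in> sets (leb T)" and Y: "Y \<in> sets \<nu>" for X Y
    proof -
      have "X \<times> Y \<in> sets (borel \<Otimes>\<^sub>M borel)"
        using X Y assms by (intro pair_measureI) (auto simp: leb_def sets_restrict_space_iff)
      then show ?thesis
        using X R unfolding borel_prod mark_space_def
        by (auto simp: leb_def sets_restrict_space_iff)
    qed
    then have "sigma_sets ({0..T} \<times> UNIV) {X \<times> Y | X Y. X \<in> sets (leb T) \<and> Y \<in> sets \<nu>}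
        \<subseteq> sets (mark_space T)"
      using sets.sigma_sets_subset[of "{X \<times> Y | X Y. X \<in> sets (leb T) \<and> Y \<in> sets \<nu>}" "mark_space T"]
      by (auto simp: mark_space_def space_restrict_space)
    then show "sets (leb T \<Otimes>\<^sub>M \<nu>) \<subseteq> sets (mark_space T)"
      using sp by (simp add: sets_pair_measure space_pair_measure)
  next
    have 1: "fst \<in> leb T \<Otimes>\<^sub>M \<nu> \<rightarrow>\<^sub>M borel"
      by (rule measurable_compose[OF measurable_fst]) (simp add: leb_def measurable_restrict_space1)
    have 2: "snd \<in> leb T \<Otimes>\<^sub>M \<nu> \<rightarrow>\<^sub>M borel"
      using measurable_snd[of "leb T" \<nu>] measurable_cong_sets[OF refl assms] by blast
    have "(\<lambda>z. (fst z, snd z)) \<in> leb T \<Otimes>\<^sub>M \<nu> \<rightarrow>\<^sub>M borel"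
      using measurable_Pair[OF 1 2] by (simp add: borel_prod)
    from measurable_sets[OF this] show "sets (mark_space T) \<subseteq> sets (leb T \<Otimes>\<^sub>M \<nu>)"
      by (auto simp: mark_space_def sets_restrict_space sp Int_commute)
  qed
qed

text \<open>Sets of infinite intensity carry the degenerate Poisson law concentrated at \<open>\<infinity>\<close>.\<close>

definition poisson_random_measure ::
    "real \<Rightarrow> (real \<times> 'u::topological_space) measure \<Rightarrow> 'w measure \<Rightarrow>
     ('w \<Rightarrow> (real \<times> 'u) measure) \<Rightarrow> bool" where
  "poisson_random_measure T \<mu> P N \<longleftrightarrow>
     N \<in> P \<rightarrow>\<^sub>M point_measures T \<and>
     (\<forall>B\<in>sets (mark_space T). emeasure \<mu> B < \<infinity> \<longrightarrow>
        (\<forall>k::nat. measure P {\<omega> \<in> space P. emeasure (N \<omega>) B = of_nat k}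
                 = measure \<mu> B ^ k / fact k * exp (- measure \<mu> B))) \<and>
     (\<forall>B\<in>sets (mark_space T). emeasure \<mu> B = \<infinity> \<longrightarrow> (AE \<omega> in P. emeasure (N \<omega>) B = \<infinity>)) \<and>
     (\<forall>(n::nat) B. (\<forall>i<n. B i \<in> sets (mark_space T)) \<and> disjoint_family_on B {..<n} \<longrightarrow>
        prob_space.indep_vars P (\<lambda>_. borel) (\<lambda>i \<omega>. emeasure (N \<omega>) (B i)) {..<n})"

text \<open>In \<open>N_sum_dirac\<close> the points are numbered from 0: \<open>X n\<close> is the point \<open>X\<^sub>n\<^sub>+\<^sub>1\<close> of the
  enumeration \<open>X\<^sub>1, X\<^sub>2, \<dots>\<close>, and it is used if \<open>n + 1 \<le> N([0,T] \<times> U)\<close>.\<close>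

locale poisson_setting = prob_space P + complete_measure P + nu: sigma_finite_measure \<nu>
  for P :: "'w measure" and \<nu> :: "'u::{real_inner, banach, polish_space} measure" +
  fixes T :: real and N :: "'w \<Rightarrow> (real \<times> 'u) measure"
  assumes T_pos: "0 < T"
    and sets_nu: "sets \<nu> = sets borel"
    and N_poisson: "poisson_random_measure T (leb T \<Otimes>\<^sub>M \<nu>) P N"
    and N_sum_dirac: "\<exists>X::nat \<Rightarrow> 'w \<Rightarrow> real \<times> 'u. (\<forall>n. X n \<in> P \<rightarrow>\<^sub>M mark_space T) \<and>
          (\<forall>\<omega>\<in>space P. \<forall>B\<in>sets (mark_space T).
             emeasure (N \<omega>) B =
               (\<Sum>n. if of_nat n < emeasure (N \<omega>) (space (mark_space T))
                    then emeasure (return (mark_space T) (X n \<omega>)) B else 0))"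
    and sets_P: "sets P =
          sets (completion (restr_to_subalg P (vimage_algebra (space P) N (point_measures T))))"


section \<open>Filtration and predictable \<open>\<sigma>\<close>-algebra\<close>

text \<open>The \<open>\<sigma>\<close>-algebra of \<open>[0,u] \<times> U\<close>; as usual for filtrations, it is completed by all null
  sets of the complete space \<open>P\<close>, and not only by those that are null for the restriction
  of \<open>P\<close> to the generated \<open>\<sigma>\<close>-algebra.\<close>

definition history ::
    "real \<Rightarrow> 'w measure \<Rightarrow> ('w \<Rightarrow> (real \<times> 'u::topological_space) measure) \<Rightarrow> real \<Rightarrow> 'w measure" where
  "history T P N u = sigma (space P)
     ({{\<omega> \<in> space P. emeasure (N \<omega>) (({0..u} \<times> UNIV) \<inter> B) \<in> A} | B A.
         B \<in> sets (mark_space T) \<and> A \<in> sets borel} \<union> null_sets P)"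

definition filtr ::
    "real \<Rightarrow> 'w measure \<Rightarrow> ('w \<Rightarrow> (real \<times> 'u::topological_space) measure) \<Rightarrow> real \<Rightarrow> 'w measure" where
  "filtr T P N t = sigma (space P)
     (if t < T then (\<Inter>u\<in>{t<..T}. sets (history T P N u)) else sets P)"

lemma (in poisson_setting) subalgebra_history: "subalgebra P (history T P N u)"
proof -
  have N: "N \<in> P \<rightarrow>\<^sub>M point_measures T"
    using N_poisson by (simp add: poisson_random_measure_def)
  have "{\<omega> \<in> space P. emeasure (N \<omega>) (({0..u} \<times> UNIV) \<inter> B) \<in> A} \<in> sets P"
    if "B \<in> sets (mark_space T)" "A \<in> sets borel" for A B
  proof -
    let ?B = "({0..u} \<times> UNIV) \<inter> B"
    have "?B \<in> sets (mark_space T)"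
    proof -
      have "{0..u} \<times> (UNIV::'u set) \<in> sets borel" by (intro borel_closed closed_Times) auto
      moreover have "{0..T} \<times> (UNIV::'u set) \<in> sets borel" by (intro borel_closed closed_Times) auto
      ultimately show ?thesis
        using that by (auto simp: mark_space_def sets_restrict_space_iff)
    qed
    then have "{\<eta> \<in> point_measure_set T. emeasure \<eta> ?B \<in> A} \<in> sets (point_measures T)"
      using that by (auto simp: point_measures_def intro!: in_measure_of)
    from measurable_sets[OF N this] have "N -` {\<eta> \<in> point_measure_set T. emeasure \<eta> ?B \<in> A} \<inter> space P \<in> sets P" .
    also have "N -` {\<eta> \<in> point_measure_set T. emeasure \<eta> ?B \<in> A} \<inter> space P
        = {\<omega> \<in> space P. emeasure (N \<omega>) ?B \<in> A}"
      using measurable_space[OF N] by (auto simp: point_measures_def space_measure_of_conv)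
    finally show ?thesis .
  qed
  then have "{{\<omega> \<in> space P. emeasure (N \<omega>) (({0..u} \<times> UNIV) \<inter> B) \<in> A} | B A.
         B \<in> sets (mark_space T) \<and> A \<in> sets borel} \<union> null_sets P \<subseteq> sets P" (is "?G \<subseteq> _") by auto
  then show ?thesis
    unfolding subalgebra_def history_def
    by (simp add: space_measure_of_conv sets_measure_of_conv sets.sigma_sets_subset)
qed

lemma (in poisson_setting) subalgebra_filtr: "subalgebra P (filtr T P N t)"
proof -
  have "(if t < T then (\<Inter>u\<in>{t<..T}. sets (history T P N u)) else sets P) \<subseteq> sets P"
    using subalgebra_history[of T] by (auto simp: subalgebra_def)
  then show ?thesis
    unfolding subalgebra_def filtr_def
    by (simp add: space_measure_of_conv sets_measure_of_conv sets.sigma_sets_subset)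
qed

definition predictable ::
    "real \<Rightarrow> 'w measure \<Rightarrow> ('w \<Rightarrow> (real \<times> 'u::topological_space) measure) \<Rightarrow> ('w \<times> real) measure" where
  "predictable T P N = sigma (space P \<times> {0..T})
     ({A \<times> {s<..t} | A s t. 0 \<le> s \<and> s < t \<and> t \<le> T \<and> A \<in> sets (filtr T P N s)} \<union>
      {A \<times> {0} | A. A \<in> sets (filtr T P N 0)})"


section \<open>\<open>L\<^sup>p\<close> spaces\<close>

text \<open>Elements of \<open>L\<^sup>p\<close> are represented by functions; all values are taken in separable spaces,
  so that strong measurability is Borel measurability.\<close>

definition Lp :: "ennreal \<Rightarrow> 'a measure \<Rightarrow> ('a \<Rightarrow> 'h::real_normed_vector) set" where
  "Lp p M = {f \<in> borel_measurable M.
     if p = \<infinity> then \<exists>C. AE x in M. norm (f x) \<le> C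
     else (\<integral>\<^sup>+x. ennreal (norm (f x) powr enn2real p) \<partial>M) < \<infinity>}"

definition Lp_norm :: "real \<Rightarrow> 'a measure \<Rightarrow> ('a \<Rightarrow> 'h::real_normed_vector) \<Rightarrow> real" where
  "Lp_norm p M f = (LINT x|M. norm (f x) powr p) powr (1 / p)"

text \<open>Points of \<open>\<Omega>\<^sub>T \<times> U\<close> are written \<open>((\<omega>, t), x)\<close>.\<close>

definition full_space :: "real \<Rightarrow> 'u measure \<Rightarrow> 'w measure \<Rightarrow> (('w \<times> real) \<times> 'u) measure" where
  "full_space T \<nu> P = (P \<Otimes>\<^sub>M leb T) \<Otimes>\<^sub>M \<nu>"

definition pred_space ::
    "real \<Rightarrow> 'u::topological_space measure \<Rightarrow> 'w measure \<Rightarrow> ('w \<Rightarrow> (real \<times> 'u) measure) \<Rightarrow>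
     (('w \<times> real) \<times> 'u) measure" where
  "pred_space T \<nu> P N = restr_to_subalg (full_space T \<nu> P) (predictable T P N \<Otimes>\<^sub>M borel)"

lemma (in poisson_setting) subalgebra_predictable:
  "subalgebra (full_space T \<nu> P) (predictable T P N \<Otimes>\<^sub>M borel)"
proof -
  have sub: "A \<in> sets P" if "A \<in> sets (filtr T P N t)" for A t
    using subalgebra_filtr that by (auto simp: subalgebra_def)
  have leb: "K \<in> sets (leb T)" if "K \<in> sets borel" "K \<subseteq> {0..T}" for K
    using that by (auto simp: leb_def sets_restrict_space_iff)
  have *: "{A \<times> {s<..t} | A s t. 0 \<le> s \<and> s < t \<and> t \<le> T \<and> A \<in> sets (filtr T P N s)} \<union>
      {A \<times> {0} | A. A \<in> sets (filtr T P N 0)} \<subseteq> sets (P \<Otimes>\<^sub>M leb T)" (is "?G \<subseteq> _")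
    using T_pos by (auto intro!: pair_measureI leb intro: sub)
  have sp: "space (P \<Otimes>\<^sub>M leb T) = space P \<times> {0..T}"
    by (simp add: space_pair_measure leb_def space_restrict_space)
  have G: "?G \<subseteq> Pow (space P \<times> {0..T})"
    by (rule subset_trans[OF *]) (use sets.space_closed[of "P \<Otimes>\<^sub>M leb T"] sp in simp)
  have sets_pr: "sets (predictable T P N) \<subseteq> sets (P \<Otimes>\<^sub>M leb T)"
    using sets.sigma_sets_subset[OF *] unfolding sp predictable_def
    by (simp add: sets_measure_of[OF G])
  have space_pr: "space (predictable T P N) = space (P \<Otimes>\<^sub>M leb T)"
    unfolding sp predictable_def by (simp add: space_measure_of[OF G])
  have "space \<nu> = UNIV"
    using sets_eq_imp_space_eq[OF sets_nu] by simp
  with space_pr have space_eq: "space (predictable T P N \<Otimes>\<^sub>M borel) = space (full_space T \<nu> P)"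
    by (simp add: full_space_def space_pair_measure)
  let ?R = "{A \<times> K | A K. A \<in> sets (predictable T P N) \<and> K \<in> sets (borel :: 'u measure)}"
  have "?R \<subseteq> sets (full_space T \<nu> P)"
    unfolding full_space_def using sets_pr sets_nu by (auto intro!: pair_measureI)
  then have "sigma_sets (space (full_space T \<nu> P)) ?R \<subseteq> sets (full_space T \<nu> P)"
    by (rule sets.sigma_sets_subset)
  also have "sigma_sets (space (full_space T \<nu> P)) ?R = sets (predictable T P N \<Otimes>\<^sub>M borel)"
    unfolding space_eq[symmetric] by (simp only: sets_pair_measure space_pair_measure)
  finally show ?thesis
    using space_eq by (simp add: subalgebra_def)
qed


section \<open>Difference operator\<close>

text \<open>The choice of the representative \<open>f\<close> of \<open>F\<close> affects the result only on a null set of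
  \<open>full_space T \<nu> P\<close>; one exists by \<open>ex_representative\<close>.\<close>

definition representative ::
    "real \<Rightarrow> 'w measure \<Rightarrow> ('w \<Rightarrow> (real \<times> 'u::topological_space) measure) \<Rightarrow> ('w \<Rightarrow> 'h) \<Rightarrow>
     (real \<times> 'u) measure \<Rightarrow> 'h::topological_space" where
  "representative T P N F =
     (SOME f. f \<in> borel_measurable (point_measures T) \<and> (AE \<omega> in P. F \<omega> = f (N \<omega>)))"

lemma borel_measurable_completion_AE_eq:
  fixes F :: "'a \<Rightarrow> 'h::second_countable_topology"
  assumes F: "F \<in> borel_measurable (completion M)"
  shows "\<exists>g\<in>borel_measurable M. AE x in M. F x = g x"
proof -
  obtain b :: "'h set set" where b: "countable b" "topological_basis b"
    using ex_countable_basis by auto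
  have "\<exists>S K. S \<in> sets M \<and> K \<in> null_sets M \<and> S \<subseteq> F -` u \<inter> space M \<and> F -` u \<inter> space M \<subseteq> S \<union> K"
    if "u \<in> b" for u
  proof -
    have "open u" using that b topological_basis_open by blast
    then have "F -` u \<inter> space M \<in> sets (completion M)"
      using measurable_sets[OF F, of u] by simp
    then obtain S K K' where "F -` u \<inter> space M = S \<union> K" "K \<subseteq> K'" "K' \<in> null_sets M" "S \<in> sets M"
      by (rule sets_completionE)
    then show ?thesis by (intro exI[of _ S] exI[of _ K']) auto
  qed
  then obtain S K where SK: "\<And>u. u \<in> b \<Longrightarrow> S u \<in> sets M" "\<And>u. u \<in> b \<Longrightarrow> K u \<in> null_sets M"
      "\<And>u. u \<in> b \<Longrightarrow> S u \<subseteq> F -` u \<inter> space M" "\<And>u. u \<in> b \<Longrightarrow> F -` u \<inter> space M \<subseteq> S u \<union> K u"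
    by metis
  define Z where "Z = (\<Union>u\<in>b. K u)"
  have Z: "Z \<in> null_sets M"
    unfolding Z_def by (rule null_sets_UN') (use b SK in auto)
  define g where "g x = (if x \<in> Z then undefined else F x)" for x
  have "g \<in> borel_measurable M"
    unfolding borel_eq_countable_basis[OF b]
  proof (rule measurable_measure_of)
    fix u assume u: "u \<in> b"
    have "g -` u \<inter> space M = (S u - Z) \<union> (if undefined \<in> u then Z else {})"
      using SK(3,4)[OF u] sets.sets_into_space[OF null_setsD2[OF Z]] u
      by (auto simp: g_def Z_def split: if_splits)
    also have "\<dots> \<in> sets M" using SK(1)[OF u] Z by auto
    finally show "g -` u \<inter> space M \<in> sets M" .
  qed auto
  moreover have "AE x in M. F x = g x"
    using AE_not_in[OF Z] by eventually_elim (simp add: g_def)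
  ultimately show ?thesis by blast
qed

lemma borel_measurable_vimage_algebra_factor:
  fixes g :: "'a \<Rightarrow> 'h::{banach, second_countable_topology}"
  assumes N: "N \<in> X \<rightarrow> space M" and g: "g \<in> borel_measurable (vimage_algebra X N M)"
  shows "\<exists>f\<in>borel_measurable M. \<forall>x\<in>X. g x = f (N x)"
proof -
  let ?V = "vimage_algebra X N M"
  obtain s where s: "\<And>i. simple_function ?V (s i)"
    and lim: "\<And>x. x \<in> space ?V \<Longrightarrow> (\<lambda>i. s i x) \<longlonglongrightarrow> g x"
    using borel_measurable_implies_sequence_metric[OF g, of 0] by metis
  have "\<exists>h\<in>borel_measurable M. \<forall>x\<in>X. s i x = h (N x)" for i
  proof -
    have fin: "finite (s i ` X)" using simple_functionD(1)[OF s[of i]] by simp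
    have "\<exists>A\<in>sets M. s i -` {y} \<inter> X = N -` A \<inter> X" for y
      using simple_functionD(2)[OF s[of i], of "{y}"] N by (auto simp: sets_vimage_algebra2)
    then obtain A where A: "\<And>y. A y \<in> sets M" "\<And>y. s i -` {y} \<inter> X = N -` A y \<inter> X" by metis
    define h where "h \<eta> = (\<Sum>y\<in>s i ` X. indicator (A y) \<eta> *\<^sub>R y)" for \<eta>
    have "h \<in> borel_measurable M" unfolding h_def using A by measurable
    moreover have "s i x = h (N x)" if x: "x \<in> X" for x
    proof -
      have *: "indicator (A y) (N x) = (if y = s i x then 1 else 0 :: real)" for y
        using A(2)[of y] x by (auto simp: indicator_def set_eq_iff)
      have "h (N x) = (\<Sum>y\<in>s i ` X. if y = s i x then y else 0)"
        unfolding h_def by (intro sum.cong refl) (simp add: *)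
      also have "\<dots> = s i x" using fin x by simp
      finally show ?thesis by simp
    qed
    ultimately show ?thesis by blast
  qed
  then obtain h where h: "\<And>i. h i \<in> borel_measurable M" "\<And>i x. x \<in> X \<Longrightarrow> s i x = h i (N x)"
    by metis
  have "(\<lambda>\<eta>. lim (\<lambda>i. h i \<eta>)) \<in> borel_measurable M"
    using h(1) by (rule borel_measurable_lim_metric)
  moreover have "g x = lim (\<lambda>i. h i (N x))" if "x \<in> X" for x
    using lim[of x] that h(2)[OF that] by (simp add: limI)
  ultimately show ?thesis by (intro bexI[of _ "\<lambda>\<eta>. lim (\<lambda>i. h i \<eta>)"]) auto
qed

lemma (in poisson_setting) ex_representative:
  fixes F :: "'w \<Rightarrow> 'h::{banach, second_countable_topology}"
  assumes "F \<in> borel_measurable P"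
  shows "\<exists>f\<in>borel_measurable (point_measures T). AE \<omega> in P. F \<omega> = f (N \<omega>)"
proof -
  let ?V = "vimage_algebra (space P) N (point_measures T)"
  have Nm: "N \<in> P \<rightarrow>\<^sub>M point_measures T"
    using N_poisson by (simp add: poisson_random_measure_def)
  then have N: "N \<in> space P \<rightarrow> space (point_measures T)"
    by (auto dest: measurable_space)
  have sub: "subalgebra P ?V"
    using Nm N by (auto simp: subalgebra_def sets_vimage_algebra2 measurable_sets)
  have "F \<in> borel_measurable (completion (restr_to_subalg P ?V))"
    using assms measurable_cong_sets[OF sets_P refl] by blast
  then obtain g where g: "g \<in> borel_measurable (restr_to_subalg P ?V)"
      "AE \<omega> in restr_to_subalg P ?V. F \<omega> = g \<omega>"
    using borel_measurable_completion_AE_eq by blast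
  then have gV: "g \<in> borel_measurable ?V"
    using measurable_cong_sets[OF sets_restr_to_subalg[OF sub] refl] by blast
  obtain f where f: "f \<in> borel_measurable (point_measures T)" "\<forall>x\<in>space P. g x = f (N x)"
    using borel_measurable_vimage_algebra_factor[OF N gV] by blast
  have "AE \<omega> in P. F \<omega> = g \<omega>" by (rule AE_restr_to_subalg[OF sub g(2)])
  then have "AE \<omega> in P. F \<omega> = f (N \<omega>)"
    using AE_space by eventually_elim (use f in auto)
  with f show ?thesis by blast
qed

definition diff_op ::
    "real \<Rightarrow> 'w measure \<Rightarrow> ('w \<Rightarrow> (real \<times> 'u::topological_space) measure) \<Rightarrow> ('w \<Rightarrow> 'h) \<Rightarrow>
     ('w \<times> real) \<times> 'u \<Rightarrow> 'h::real_normed_vector" where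
  "diff_op T P N F = (\<lambda>((\<omega>, t), x).
     representative T P N F (add_dirac (N \<omega>) (t, x)) - representative T P N F (N \<omega>))"


section \<open>Stochastic integral\<close>

text \<open>The compensated measure \<open>N - \<lambda> \<otimes> \<nu>\<close>, for sets of finite intensity.\<close>

definition compensated ::
    "real \<Rightarrow> 'u measure \<Rightarrow> ('w \<Rightarrow> (real \<times> 'u) measure) \<Rightarrow> (real \<times> 'u) set \<Rightarrow> 'w \<Rightarrow> real" where
  "compensated T \<nu> N A \<omega> = measure (N \<omega>) A - measure (leb T \<Otimes>\<^sub>M \<nu>) A"

text \<open>\<open>I\<close> represents the continuous linear map from \<open>L\<^sup>p\<close> of \<open>pred_space\<close> to \<open>L\<^sup>p\<close> of \<open>P\<close> that
  extends the elementary integral. Linearity and the values on elementary integrands are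
  equations between equivalence classes; that \<open>I\<close> respects equality almost everywhere follows
  from linearity and boundedness. These properties determine \<open>I\<close> on \<open>L\<^sup>p\<close> up to equality
  almost surely.\<close>

definition is_stochastic_integral ::
    "real \<Rightarrow> 'u::topological_space measure \<Rightarrow> 'w measure \<Rightarrow> ('w \<Rightarrow> (real \<times> 'u) measure) \<Rightarrow> real \<Rightarrow>
     ((('w \<times> real) \<times> 'u \<Rightarrow> 'h::real_normed_vector) \<Rightarrow> 'w \<Rightarrow> 'h) \<Rightarrow> bool" where
  "is_stochastic_integral T \<nu> P N p I \<longleftrightarrow>
     (\<forall>\<Phi>\<in>Lp (ennreal p) (pred_space T \<nu> P N). I \<Phi> \<in> Lp (ennreal p) P) \<and>
     (\<forall>\<Phi>\<in>Lp (ennreal p) (pred_space T \<nu> P N). \<forall>\<Psi>\<in>Lp (ennreal p) (pred_space T \<nu> P N).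
        AE \<omega> in P. I (\<lambda>z. \<Phi> z + \<Psi> z) \<omega> = I \<Phi> \<omega> + I \<Psi> \<omega>) \<and>
     (\<forall>c. \<forall>\<Phi>\<in>Lp (ennreal p) (pred_space T \<nu> P N).
        AE \<omega> in P. I (\<lambda>z. c *\<^sub>R \<Phi> z) \<omega> = c *\<^sub>R I \<Phi> \<omega>) \<and>
     (\<exists>C. \<forall>\<Phi>\<in>Lp (ennreal p) (pred_space T \<nu> P N).
        Lp_norm p P (I \<Phi>) \<le> C * Lp_norm p (pred_space T \<nu> P N) \<Phi>) \<and>
     (\<forall>r s G B. 0 \<le> r \<and> r \<le> s \<and> s \<le> T \<and> G \<in> borel_measurable (filtr T P N r) \<and>
        (\<exists>C. \<forall>\<omega>\<in>space P. norm (G \<omega>) \<le> C) \<and> B \<in> sets borel \<and> emeasure \<nu> B < \<infinity> \<longrightarrow>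
        (AE \<omega> in P. I (\<lambda>((\<omega>, t), x). indicator ({r<..s} \<times> B) (t, x) *\<^sub>R G \<omega>) \<omega>
                     = compensated T \<nu> N ({r<..s} \<times> B) \<omega> *\<^sub>R G \<omega>))"

end

theory Submission
  imports Defs
begin

text \<open>
  The identity says that, on predictable integrands, the stochastic integral is the adjoint of
  the difference operator. It rests on the Mecke equation
  \<open>E (\<integral> g(N) 1\<^sub>C dN) = E \<integral>\<^sub>C g(N + \<delta>\<^sub>z) \<mu>(dz)\<close> with \<open>\<mu> = \<lambda> \<otimes> \<nu>\<close> (lemma \<open>mecke\<close>).

  Consider first \<open>\<Phi> = 1\<^sub>A 1\<^sub>C h\<close> with a rectangle \<open>C = (u,s] \<times> b\<close> and an event \<open>A\<close> that is determined
  by the points in \<open>[0,u]\<close>. With \<open>f(N) = \<langle>F, h\<rangle>\<close>, the Mecke equation for \<open>g = 1\<^sub>A f\<close> turns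
  \<open>E (1\<^sub>A f(N) N(C))\<close> into the integral of \<open>f(N + \<delta>\<^sub>z)\<close> over \<open>A\<close> and \<open>z \<in> C\<close>: a point that is added
  after time \<open>u\<close> cannot change whether \<open>A\<close> occurs. Subtracting \<open>\<mu>(C) E (1\<^sub>A f(N))\<close>, the
  compensator on the left becomes the term \<open>f(N)\<close> in \<open>D F = f(N + \<delta>\<^sub>z) - f(N)\<close> on the right
  (\<open>duality_rectangle\<close>). An event of \<open>\<F>\<^sub>r\<close> itself may look infinitesimally
  beyond \<open>r\<close>; it is handled by letting \<open>u\<close> decrease to \<open>r\<close> (\<open>dual_set_rectangle\<close>).

  Both sides are linear and \<open>L\<^sup>p\<close>-continuous in \<open>\<Phi>\<close>: pairing with an element of \<open>L\<^sup>p\<^sup>'\<close> is a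
  bounded functional on \<open>L\<^sup>p\<close> (\<open>Lp_pairing_bounded\<close>), applied to \<open>F\<close> on the left and to
  \<open>1\<^sub>B D F\<close> on the right. Hence the integrands that satisfy the identity are closed under sums
  and dominated limits (\<open>dual_limit\<close>), and the monotone class argument extends the identity from
  rectangles to predictable sets, simple functions and finally all predictable integrands that
  vanish off \<open>B\<close>.

  The Mecke equation compares two finite measures on the space of point measures, so it is enough
  to test it on events given by finitely many counts. After passing to a common disjoint
  refinement these counts are sums of independent variables, and the assertion reduces to the
  identity \<open>E (Y g(Y, Z)) = m E g(Y + 1, Z)\<close> for a Poisson variable \<open>Y\<close> with mean \<open>m\<close> that is
  independent of \<open>Z\<close> (\<open>poisson_size_bias\<close>).\<close>

section \<open>Bounded pairings and dominated convergence in \<open>L\<^sup>p\<close>\<close>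

lemma Lp_iff_integrable:
  fixes g :: "'a \<Rightarrow> 'h::{real_normed_vector, second_countable_topology}"
  assumes "0 \<le> p"
  shows "g \<in> Lp (ennreal p) M \<longleftrightarrow>
    g \<in> borel_measurable M \<and> integrable M (\<lambda>x. norm (g x) powr p)"
  using assms by (auto simp: Lp_def integrable_iff_bounded)

text \<open>The bound forces \<open>w\<close> to be nonnegative almost everywhere, so that \<open>powr\<close> is monotone there.\<close>

lemma Lp_dominated:
  fixes g :: "'a \<Rightarrow> 'h::{real_normed_vector, second_countable_topology}"
  assumes "0 \<le> p" and g: "g \<in> borel_measurable M"
    and w: "integrable M (\<lambda>x. w x powr p)" and le: "AE x in M. norm (g x) \<le> w x"
  shows "g \<in> Lp (ennreal p) M"
proof -
  have "integrable M (\<lambda>x. norm (g x) powr p)"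
  proof (rule Bochner_Integration.integrable_bound[OF w])
    show "AE x in M. norm (norm (g x) powr p) \<le> norm (w x powr p)"
      using le by eventually_elim (use assms(1) in \<open>auto intro!: powr_mono2\<close>)
  qed (use g in measurable)
  with assms show ?thesis by (simp add: Lp_iff_integrable)
qed

lemma Lp_add:
  fixes f g :: "'a \<Rightarrow> 'h::{real_normed_vector, second_countable_topology}"
  assumes "0 \<le> p" and f: "f \<in> Lp (ennreal p) M" and g: "g \<in> Lp (ennreal p) M"
  shows "(\<lambda>x. f x + g x) \<in> Lp (ennreal p) M"
proof (rule Lp_dominated[where w = "\<lambda>x. 2 * max (norm (f x)) (norm (g x))"])
  have [measurable]: "f \<in> borel_measurable M" "g \<in> borel_measurable M"
    using assms by (auto simp: Lp_iff_integrable)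
  have "integrable M (\<lambda>x. 2 powr p * (norm (f x) powr p + norm (g x) powr p))"
    using assms by (auto simp: Lp_iff_integrable)
  then show "integrable M (\<lambda>x. (2 * max (norm (f x)) (norm (g x))) powr p)"
    by (rule Bochner_Integration.integrable_bound)
      (auto intro!: AE_I2 simp: powr_mult max_def mult_left_mono)
  show "AE x in M. norm (f x + g x) \<le> 2 * max (norm (f x)) (norm (g x))"
  proof (rule AE_I2)
    fix x show "norm (f x + g x) \<le> 2 * max (norm (f x)) (norm (g x))"
      using norm_triangle_ineq[of "f x" "g x"] by linarith
  qed
  show "(\<lambda>x. f x + g x) \<in> borel_measurable M" by measurable
qed fact

lemma Lp_scaleR:
  fixes f :: "'a \<Rightarrow> 'h::{real_normed_vector, second_countable_topology}"
  assumes "0 \<le> p" and f: "f \<in> Lp (ennreal p) M"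
  shows "(\<lambda>x. c *\<^sub>R f x) \<in> Lp (ennreal p) M"
  using assms by (auto simp: Lp_iff_integrable powr_mult)

lemma Lp_norm_dominated_tendsto:
  fixes u :: "nat \<Rightarrow> 'a \<Rightarrow> 'h::{real_normed_vector, second_countable_topology}"
  assumes p: "0 < p" and [measurable]: "\<And>n. u n \<in> borel_measurable M" "v \<in> borel_measurable M"
    and w: "integrable M (\<lambda>x. w x powr p)"
    and le: "\<And>n. AE x in M. norm (u n x) \<le> w x"
    and lim: "AE x in M. (\<lambda>n. u n x) \<longlonglongrightarrow> v x"
  shows "(\<lambda>n. Lp_norm p M (\<lambda>x. u n x - v x)) \<longlonglongrightarrow> 0"
proof -
  have v_le: "AE x in M. norm (v x) \<le> w x"
  proof -
    have "AE x in M. \<forall>n. norm (u n x) \<le> w x" using le by (simp add: AE_all_countable)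
    with lim show ?thesis
      by eventually_elim (rule tendsto_upperbound[OF tendsto_norm], auto)
  qed
  have "(\<lambda>n. LINT x|M. norm (u n x - v x) powr p) \<longlonglongrightarrow> (LINT x|M. 0)"
  proof (rule integral_dominated_convergence)
    show "integrable M (\<lambda>x. 2 powr p * w x powr p)" using w by simp
    show "AE x in M. (\<lambda>n. norm (u n x - v x) powr p) \<longlonglongrightarrow> 0"
      using lim
    proof eventually_elim
      case (elim x)
      have "(\<lambda>n. norm (u n x - v x)) \<longlonglongrightarrow> 0"
        using elim by (simp add: LIM_zero tendsto_norm_zero)
      then have "(\<lambda>n. norm (u n x - v x) powr p) \<longlonglongrightarrow> 0 powr p"
        by (rule tendsto_powr2) (use p in auto)
      then show ?case by simp
    qed
    show "AE x in M. norm (norm (u n x - v x) powr p) \<le> 2 powr p * w x powr p" for n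
      using le[of n] v_le
    proof eventually_elim
      case (elim x)
      have "norm (u n x - v x) \<le> 2 * w x"
        using elim norm_triangle_ineq4[of "u n x" "v x"] by linarith
      then have "norm (u n x - v x) powr p \<le> (2 * w x) powr p"
        using p by (intro powr_mono2) auto
      also have "\<dots> = 2 powr p * w x powr p"
        by (rule powr_mult)
      finally show ?case by simp
    qed
  qed measurable
  then have "(\<lambda>n. (LINT x|M. norm (u n x - v x) powr p) powr (1 / p)) \<longlonglongrightarrow> 0 powr (1 / p)"
    by (intro tendsto_powr2 tendsto_const) (use p in auto)
  with p show ?thesis by (simp add: Lp_norm_def)
qed

text \<open>Hoelder's inequality up to the value of the constant, which is all that continuity needs.
  Accepting the constant \<open>K = \<parallel>f\<parallel>\<^sup>r / r + 1 / p\<close>, where \<open>r\<close> is the finite value of \<open>q\<close>, allows a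
  short proof: apply Young's inequality to \<open>f\<close> and to \<open>g\<close> scaled to norm one. For \<open>q = \<infinity>\<close>, the
  constant is an essential bound of \<open>f\<close>.\<close>

lemma Lp_pairing_bounded:
  fixes f :: "'a \<Rightarrow> 'h::{real_inner, second_countable_topology}"
  assumes p: "1 \<le> p" and q: "1 / ennreal p + 1 / q = 1" and f: "f \<in> Lp q M"
  shows "\<exists>K\<ge>0. \<forall>g\<in>Lp (ennreal p) M.
    integrable M (\<lambda>x. f x \<bullet> g x) \<and> \<bar>LINT x|M. f x \<bullet> g x\<bar> \<le> K * Lp_norm p M g"
proof -
  have fm [measurable]: "f \<in> borel_measurable M" using f by (simp add: Lp_def)
  show ?thesis
  proof (cases "q = \<infinity>")
    case True
    have "ennreal p = 1"
    proof -
      have "1 / ennreal p = 1" using q True by (simp add: divide_ennreal_def)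
      then have "1 / p = 1"
        using p by (simp flip: ennreal_1 add: divide_ennreal)
      then show ?thesis by simp
    qed
    then have p1: "p = 1" using p by simp
    obtain C where C: "AE x in M. norm (f x) \<le> C" using f True by (auto simp: Lp_def)
    show ?thesis
    proof (intro exI[of _ "\<bar>C\<bar>"] conjI ballI)
      fix g :: "'a \<Rightarrow> 'h" assume "g \<in> Lp (ennreal p) M"
      then have g [measurable]: "g \<in> borel_measurable M" and gi: "integrable M (\<lambda>x. norm (g x))"
        using Lp_iff_integrable[of p g M] by (auto simp: p1)
      have le: "AE x in M. norm (f x \<bullet> g x) \<le> \<bar>C\<bar> * norm (g x)"
        using C
      proof eventually_elim
        case (elim x)
        have "norm (f x \<bullet> g x) \<le> norm (f x) * norm (g x)" by (simp add: Cauchy_Schwarz_ineq2)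
        also have "\<dots> \<le> \<bar>C\<bar> * norm (g x)" using elim by (intro mult_right_mono) auto
        finally show ?case .
      qed
      have int: "integrable M (\<lambda>x. \<bar>C\<bar> * norm (g x))" using gi by simp
      show fg: "integrable M (\<lambda>x. f x \<bullet> g x)"
        by (rule Bochner_Integration.integrable_bound[OF int]) (use le in auto)
      have "norm (LINT x|M. f x \<bullet> g x) \<le> (LINT x|M. \<bar>C\<bar> * norm (g x))"
        using fg int le
        by (intro order_trans[OF integral_norm_bound] integral_mono_AE) auto
      then show "\<bar>LINT x|M. f x \<bullet> g x\<bar> \<le> \<bar>C\<bar> * Lp_norm p M g"
        by (simp add: Lp_norm_def p1)
    qed auto
  next
    case False
    then obtain r where r: "q = ennreal r" "0 \<le> r" by (cases q) auto
    have r0: "r > 0"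
    proof (rule ccontr)
      assume "\<not> r > 0"
      then have "1 / q = top" using r by (simp add: divide_ennreal_def)
      with q show False by simp
    qed
    have pr: "1 / p + 1 / r = 1"
    proof -
      have "ennreal (1 / p + 1 / r) = ennreal 1"
        using q r r0 p by (simp add: divide_ennreal flip: ennreal_1)
      then show ?thesis using p r0 by (subst (asm) ennreal_inj) auto
    qed
    have p1: "1 < p"
    proof (rule ccontr)
      assume "\<not> 1 < p" with p have "p = 1" by simp
      with pr r0 show False by simp
    qed
    have r1: "1 < r"
    proof (rule ccontr)
      assume "\<not> 1 < r"
      then have "1 \<le> 1 / r" using r0 by simp
      moreover have "0 < 1 / p" using p1 by simp
      ultimately show False using pr by linarith
    qed
    have fr: "integrable M (\<lambda>x. norm (f x) powr r)" using f r by (simp add: Lp_iff_integrable)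
    define K where "K = (LINT x|M. norm (f x) powr r) / r + 1 / p"
    have K: "0 \<le> K" unfolding K_def using r1 p1 by (intro add_nonneg_nonneg divide_nonneg_pos) auto
    show ?thesis
    proof (intro exI[of _ K] conjI ballI K)
      fix g :: "'a \<Rightarrow> 'h" assume "g \<in> Lp (ennreal p) M"
      then have g [measurable]: "g \<in> borel_measurable M"
        and gi: "integrable M (\<lambda>x. norm (g x) powr p)"
        using p by (auto simp: Lp_iff_integrable)
      have bound: "\<bar>f x \<bullet> (c *\<^sub>R g x)\<bar> \<le> norm (f x) powr r / r + c powr p * norm (g x) powr p / p"
        if "0 \<le> c" for c x
      proof -
        have "\<bar>f x \<bullet> (c *\<^sub>R g x)\<bar> \<le> norm (f x) * norm (c *\<^sub>R g x)" by (rule Cauchy_Schwarz_ineq2)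
        also have "\<dots> \<le> norm (f x) powr r / r + norm (c *\<^sub>R g x) powr p / p"
          using p1 r1 pr by (intro Youngs_inequality) auto
        finally show ?thesis using that by (simp add: powr_mult)
      qed
      have rhs: "integrable M (\<lambda>x. norm (f x) powr r / r + c powr p * norm (g x) powr p / p)" for c
        using fr gi by auto
      show fg: "integrable M (\<lambda>x. f x \<bullet> g x)"
      proof (rule Bochner_Integration.integrable_bound[OF rhs[of 1]])
        have "norm (f x \<bullet> g x) \<le> norm (norm (f x) powr r / r + 1 powr p * norm (g x) powr p / p)" for x
          using bound[of 1 x] by simp
        then show "AE x in M. norm (f x \<bullet> g x) \<le>
            norm (norm (f x) powr r / r + 1 powr p * norm (g x) powr p / p)" by simp
      qed measurable
      let ?L = "Lp_norm p M g"
      have L: "?L \<ge> 0" by (simp add: Lp_norm_def)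
      have Lp: "?L powr p = (LINT x|M. norm (g x) powr p)"
        unfolding Lp_norm_def using p1 by (simp add: powr_powr)
      show "\<bar>LINT x|M. f x \<bullet> g x\<bar> \<le> K * ?L"
      proof (cases "?L = 0")
        case True
        then have "(LINT x|M. norm (g x) powr p) = 0" using Lp p1 by simp
        then have "AE x in M. g x = 0"
          using integral_nonneg_eq_0_iff_AE[OF gi] by simp
        then have "(LINT x|M. f x \<bullet> g x) = (LINT x|M. 0)"
          by (intro integral_cong_AE) auto
        with True show ?thesis by simp
      next
        case False
        with L have L': "?L > 0" by simp
        let ?c = "1 / ?L"
        have "\<bar>LINT x|M. f x \<bullet> (?c *\<^sub>R g x)\<bar> \<le>
            (LINT x|M. norm (f x) powr r / r + ?c powr p * norm (g x) powr p / p)"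
        proof (intro order_trans[OF integral_abs_bound] integral_mono)
          show "integrable M (\<lambda>x. \<bar>f x \<bullet> (?c *\<^sub>R g x)\<bar>)" using fg by simp
          show "\<bar>f x \<bullet> (?c *\<^sub>R g x)\<bar> \<le> norm (f x) powr r / r + ?c powr p * norm (g x) powr p / p" for x
            using L' by (intro bound) simp
        qed (rule rhs)
        also have "\<dots> = (LINT x|M. norm (f x) powr r) / r + ?c powr p * (LINT x|M. norm (g x) powr p) / p"
          using fr gi by simp
        also have "\<dots> = K"
          using L' by (simp add: K_def powr_divide flip: Lp)
        finally show ?thesis using L' by (simp add: field_simps abs_mult)
      qed
    qed
  qed
qed

lemma Lp_indicator:
  fixes h :: "'h::{real_normed_vector, second_countable_topology}"
  assumes "0 < p" "E \<in> sets M" "emeasure M E < \<infinity>"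
  shows "(\<lambda>z. indicator E z *\<^sub>R h) \<in> Lp (ennreal p) M"
proof -
  have "(\<lambda>z. norm (indicator E z *\<^sub>R h) powr p) = (\<lambda>z. indicator E z * norm h powr p)"
    using assms(1) by (auto simp: indicator_def)
  moreover have "integrable M (\<lambda>z. indicator E z * norm h powr p :: real)"
    using assms by (intro integrable_mult_left integrable_real_indicator)
  ultimately show ?thesis using assms by (simp add: Lp_iff_integrable)
qed

section \<open>Size-biased Poisson variables and finite partitions\<close>

text \<open>Size-biasing a Poisson variable shifts it by one, because
  \<open>(k + 1) m\<^sup>k\<^sup>+\<^sup>1 / (k + 1)! = m (m\<^sup>k / k!)\<close>. The predicate \<open>Q y\<close> carries the further randomness,
  which is independent of \<open>Y\<close>; this is the one-dimensional core of the Mecke equation.\<close>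

lemma (in prob_space) poisson_size_bias:
  fixes Y :: "'a \<Rightarrow> ennreal" and Q :: "ennreal \<Rightarrow> 'a \<Rightarrow> bool"
  assumes [measurable]: "Y \<in> borel_measurable M" and m: "0 \<le> m"
    and poisson: "\<And>k::nat. prob {\<omega> \<in> space M. Y \<omega> = of_nat k} = m ^ k / fact k * exp (- m)"
    and [measurable]: "\<And>y. Measurable.pred M (Q y)"
    and indep: "\<And>(k::nat) y. prob {\<omega> \<in> space M. Y \<omega> = of_nat k \<and> Q y \<omega>} =
      prob {\<omega> \<in> space M. Y \<omega> = of_nat k} * prob {\<omega> \<in> space M. Q y \<omega>}"
  shows "(\<integral>\<^sup>+\<omega>. Y \<omega> * indicator {\<omega>. Q (Y \<omega>) \<omega>} \<omega> \<partial>M) =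
    ennreal m * (\<integral>\<^sup>+\<omega>. indicator {\<omega>. Q (Y \<omega> + 1) \<omega>} \<omega> \<partial>M)"
proof -
  let ?E = "\<lambda>k::nat. {\<omega> \<in> space M. Y \<omega> = of_nat k}"
  have "(\<lambda>k. prob (?E k)) sums prob (\<Union>k. ?E k)"
    by (intro finite_measure_UNION) (auto simp: disjoint_family_on_def)
  moreover have "(\<lambda>k. prob (?E k)) sums (exp m * exp (- m))"
    unfolding poisson using exp_converges[of m]
    by (intro sums_mult2) (simp add: divide_inverse mult.commute scaleR_conv_of_real)
  \<comment> \<open>The values of \<open>Y\<close> are extended reals; that \<open>\<infinity>\<close> is not charged follows as the Poisson weights sum to one.\<close>
  ultimately have "prob (\<Union>k. ?E k) = 1"
    using sums_unique2 by (fastforce simp flip: exp_add)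
  then have "AE \<omega> in M. \<omega> \<in> (\<Union>k. ?E k)"
    by (subst (asm) prob_eq_1) auto
  then have fin: "AE \<omega> in M. \<exists>k::nat. Y \<omega> = of_nat k"
    by eventually_elim auto
  have expand: "AE \<omega> in M. h (Y \<omega>) \<omega> =
      (\<Sum>k. h (of_nat k) \<omega> * indicator {\<omega>. Y \<omega> = of_nat k} \<omega>)"
    for h :: "ennreal \<Rightarrow> 'a \<Rightarrow> ennreal"
    using fin
  proof eventually_elim
    case (elim \<omega>)
    then obtain k :: nat where k: "Y \<omega> = of_nat k" by blast
    have "(\<Sum>j. h (of_nat j) \<omega> * indicator {\<omega>. Y \<omega> = of_nat j} \<omega>) =
        (\<Sum>j\<in>{k}. h (of_nat j) \<omega> * indicator {\<omega>. Y \<omega> = of_nat j} \<omega>)"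
      by (rule suminf_finite) (auto simp: k)
    then show ?case by (simp add: k)
  qed
  have prob_em: "emeasure M {\<omega> \<in> space M. Y \<omega> = of_nat k \<and> Q y \<omega>} =
      ennreal (m ^ k / fact k * exp (- m)) * emeasure M {\<omega> \<in> space M. Q y \<omega>}" for k :: nat and y
    unfolding emeasure_eq_measure indep poisson using m by (intro ennreal_mult) auto
  have "(\<integral>\<^sup>+\<omega>. Y \<omega> * indicator {\<omega>. Q (Y \<omega>) \<omega>} \<omega> \<partial>M) =
      (\<integral>\<^sup>+\<omega>. (\<Sum>k. (of_nat k * indicator {\<omega>. Q (of_nat k) \<omega>} \<omega>) *
        indicator {\<omega>. Y \<omega> = of_nat k} \<omega>) \<partial>M)"
    by (rule nn_integral_cong_AE,
        use expand[of "\<lambda>y \<omega>. y * indicator {\<omega>. Q y \<omega>} \<omega>"] in eventually_elim)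
      (simp add: indicator_def)
  also have "\<dots> = (\<Sum>k. \<integral>\<^sup>+\<omega>. (of_nat k * indicator {\<omega>. Q (of_nat k) \<omega>} \<omega>) *
        indicator {\<omega>. Y \<omega> = of_nat k} \<omega> \<partial>M)"
    by (rule nn_integral_suminf) measurable
  also have "\<dots> = (\<Sum>k. \<integral>\<^sup>+\<omega>. of_nat k *
        indicator {\<omega> \<in> space M. Y \<omega> = of_nat k \<and> Q (of_nat k) \<omega>} \<omega> \<partial>M)"
    by (intro suminf_cong nn_integral_cong) (auto simp: indicator_def)
  also have "\<dots> = (\<Sum>k. of_nat k *
        (ennreal (m ^ k / fact k * exp (- m)) * emeasure M {\<omega> \<in> space M. Q (of_nat k) \<omega>}))"
    unfolding prob_em[symmetric] by (intro suminf_cong nn_integral_cmult_indicator) measurable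
  also have "\<dots> = (\<Sum>k. of_nat (Suc k) * (ennreal (m ^ Suc k / fact (Suc k) * exp (- m)) *
      emeasure M {\<omega> \<in> space M. Q (of_nat (Suc k)) \<omega>}))"
    by (subst suminf_offset[of _ 1]) auto
  also have "\<dots> = (\<Sum>k. ennreal m * (ennreal (m ^ k / fact k * exp (- m)) *
      emeasure M {\<omega> \<in> space M. Q (of_nat (Suc k)) \<omega>}))"
  proof (intro suminf_cong)
    fix k
    have "real (Suc k) * (m ^ Suc k / fact (Suc k) * exp (- m)) = m * (m ^ k / fact k * exp (- m))"
      by (simp add: fact_Suc del: of_nat_Suc)
    then have "ennreal (real (Suc k)) * ennreal (m ^ Suc k / fact (Suc k) * exp (- m)) =
        ennreal m * ennreal (m ^ k / fact k * exp (- m))"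
      using m by (subst (1 2) ennreal_mult[symmetric]) auto
    then show "of_nat (Suc k) * (ennreal (m ^ Suc k / fact (Suc k) * exp (- m)) *
      emeasure M {\<omega> \<in> space M. Q (of_nat (Suc k)) \<omega>}) = ennreal m * (ennreal (m ^ k / fact k * exp (- m)) *
      emeasure M {\<omega> \<in> space M. Q (of_nat (Suc k)) \<omega>})"
      unfolding ennreal_of_nat_eq_real_of_nat mult.assoc[symmetric] by (rule arg_cong)
  qed
  also have "\<dots> = ennreal m * (\<Sum>k. ennreal (m ^ k / fact k * exp (- m)) *
      emeasure M {\<omega> \<in> space M. Q (of_nat (Suc k)) \<omega>})"
    by (rule ennreal_suminf_cmult)
  also have "(\<Sum>k. ennreal (m ^ k / fact k * exp (- m)) *
      emeasure M {\<omega> \<in> space M. Q (of_nat (Suc k)) \<omega>}) =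
      (\<Sum>k. \<integral>\<^sup>+\<omega>. indicator {\<omega>. Q (of_nat k + 1) \<omega>} \<omega> * indicator {\<omega>. Y \<omega> = of_nat k} \<omega> \<partial>M)"
    unfolding prob_em[symmetric]
    by (subst nn_integral_indicator[symmetric], measurable)
      (intro suminf_cong nn_integral_cong, auto simp: indicator_def add.commute)
  also have "\<dots> = (\<integral>\<^sup>+\<omega>. (\<Sum>k. indicator {\<omega>. Q (of_nat k + 1) \<omega>} \<omega> *
      indicator {\<omega>. Y \<omega> = of_nat k} \<omega>) \<partial>M)"
    by (rule nn_integral_suminf[symmetric]) measurable
  also have "\<dots> = (\<integral>\<^sup>+\<omega>. indicator {\<omega>. Q (Y \<omega> + 1) \<omega>} \<omega> \<partial>M)"
    by (rule nn_integral_cong_AE,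
        use expand[of "\<lambda>y \<omega>. indicator {\<omega>. Q (y + 1) \<omega>} \<omega>"] in eventually_elim)
      (simp add: indicator_def)
  finally show ?thesis .
qed

text \<open>Counts of overlapping sets are dependent. On the cells of a finite partition that refines the
  given sets they are independent, and the original counts are sums of these.\<close>

lemma ex_disjoint_refinement:
  fixes B :: "nat \<Rightarrow> 'a set"
  assumes "\<And>i. i < n \<Longrightarrow> B i \<in> sets M"
  shows "\<exists>(m::nat) D S. (\<forall>j<m. D j \<in> sets M) \<and> disjoint_family_on D {..<m} \<and>
    (\<Union>j<m. D j) = space M \<and> (\<forall>i<n. S i \<subseteq> {..<m} \<and> B i = (\<Union>j\<in>S i. D j))"
  using assms
proof (induction n)
  case 0
  show ?case
    by (intro exI[of _ "1::nat"] exI[of _ "\<lambda>_. space M"]) (auto simp: disjoint_family_on_def)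
next
  case (Suc n)
  then obtain m D S where IH: "\<forall>j<m::nat. D j \<in> sets M" "disjoint_family_on D {..<m}"
      "(\<Union>j<m. D j) = space M" "\<forall>i<n. S i \<subseteq> {..<m} \<and> B i = (\<Union>j\<in>S i. D j)"
    by (metis less_SucI)
  have Bn: "B n \<in> sets M" using Suc.prems by simp
  \<comment> \<open>Each cell is split by the new set: cell \<open>j\<close> becomes its part inside, cell \<open>m + j\<close> its part outside.\<close>
  define D' where "D' j = (if j < m then D j \<inter> B n else D (j - m) - B n)" for j
  define S' where "S' i = (if i < n then S i \<union> (\<lambda>j. m + j) ` S i else {..<m})" for i
  have split: "(\<Union>j\<in>R \<union> (\<lambda>j. m + j) ` R. D' j) = (\<Union>j\<in>R. D j)" if "R \<subseteq> {..<m}" for R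
    using that by (auto simp: D'_def subset_iff)
  have all: "{..<m + m} = {..<m} \<union> (\<lambda>j. m + j) ` {..<m}"
  proof (intro set_eqI iffI)
    fix j assume "j \<in> {..<m + m}"
    then show "j \<in> {..<m} \<union> (\<lambda>j. m + j) ` {..<m}"
      by (cases "j < m") (auto simp: image_iff intro!: bexI[of _ "j - m"])
  qed auto
  show ?case
  proof (intro exI[of _ "m + m"] exI[of _ D'] exI[of _ S'] conjI allI impI)
    fix j assume "j < m + m"
    with IH(1) Bn show "D' j \<in> sets M" by (auto simp: D'_def)
  next
    show "disjoint_family_on D' {..<m + m}"
    proof (unfold disjoint_family_on_def, intro ballI impI)
      fix i j assume ij: "i \<in> {..<m + m}" "j \<in> {..<m + m}" "i \<noteq> j"
      have D: "D a \<inter> D b = {}" if "a < m" "b < m" "a \<noteq> b" for a b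
        using IH(2) that by (auto simp: disjoint_family_on_def)
      consider "i < m" "j < m" | "i < m" "\<not> j < m" | "\<not> i < m" "j < m" | "\<not> i < m" "\<not> j < m"
        by blast
      then show "D' i \<inter> D' j = {}"
      proof cases
        case 1 then show ?thesis using D[of i j] ij by (auto simp: D'_def)
      next
        case 4
        then have "i - m < m" "j - m < m" "i - m \<noteq> j - m" using ij by auto
        then have "D (i - m) \<inter> D (j - m) = {}" by (rule D)
        with 4 show ?thesis by (auto simp: D'_def)
      qed (auto simp: D'_def)
    qed
  next
    show "(\<Union>j<m + m. D' j) = space M" unfolding all IH(3)[symmetric] by (rule split) simp
  next
    fix i assume "i < Suc n"
    show "S' i \<subseteq> {..<m + m}"
    proof (cases "i < n")
      case True
      then have "S i \<subseteq> {..<m}" using IH(4) by blast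
      then show ?thesis using True by (auto simp: S'_def)
    qed (auto simp: S'_def)
  next
    fix i assume i: "i < Suc n"
    show "B i = (\<Union>j\<in>S' i. D' j)"
    proof (cases "i < n")
      case True
      then show ?thesis using IH(4) split[of "S i"] by (simp add: S'_def)
    next
      case False
      then have "i = n" using i by simp
      moreover have "(\<Union>j<m. D' j) = (\<Union>j<m. D j) \<inter> B n" by (auto simp: D'_def)
      ultimately show ?thesis using sets.sets_into_space[OF Bn] IH(3) by (auto simp: S'_def)
    qed
  qed
qed

section \<open>Measurability on the space of point measures\<close>

lemma space_point_measures [simp]: "space (point_measures T) = point_measure_set T"
  by (simp add: point_measures_def space_measure_of_conv)

lemma sets_point_measures:
  "sets (point_measures T) = sigma_sets (point_measure_set T)
     {{\<eta> \<in> point_measure_set T. emeasure \<eta> B \<in> A} | B A. B \<in> sets (mark_space T) \<and> A \<in> sets borel}"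
  unfolding point_measures_def by (rule sets_measure_of) auto

lemma measurable_emeasure_point_measures [measurable]:
  assumes "B \<in> sets (mark_space T)"
  shows "(\<lambda>\<eta>. emeasure \<eta> B) \<in> borel_measurable (point_measures T)"
proof (rule measurableI)
  fix A :: "ennreal set" assume A: "A \<in> sets borel"
  have "(\<lambda>\<eta>. emeasure \<eta> B) -` A \<inter> space (point_measures T) =
      {\<eta> \<in> point_measure_set T. emeasure \<eta> B \<in> A}"
    by auto
  also have "\<dots> \<in> sets (point_measures T)"
    unfolding sets_point_measures using assms A by blast
  finally show "(\<lambda>\<eta>. emeasure \<eta> B) -` A \<inter> space (point_measures T) \<in> sets (point_measures T)" .
qed auto

lemma measurable_point_measuresI:
  fixes f :: "'a \<Rightarrow> (real \<times> 'u::topological_space) measure"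
  assumes "\<And>x. x \<in> space M \<Longrightarrow> f x \<in> point_measure_set T"
    and "\<And>B. B \<in> sets (mark_space T) \<Longrightarrow> (\<lambda>x. emeasure (f x) B) \<in> borel_measurable M"
  shows "f \<in> M \<rightarrow>\<^sub>M point_measures T"
  unfolding point_measures_def
proof (rule measurable_measure_of)
  fix G :: "(real \<times> 'u) measure set"
  assume "G \<in> {{\<eta> \<in> point_measure_set T. emeasure \<eta> B \<in> A} | B A.
    B \<in> sets (mark_space T) \<and> A \<in> sets borel}"
  then obtain B A where G: "G = {\<eta> \<in> point_measure_set T. emeasure \<eta> B \<in> A}"
    and B: "B \<in> sets (mark_space T)" and A: "A \<in> sets borel" by blast
  have "f -` G \<inter> space M = (\<lambda>x. emeasure (f x) B) -` A \<inter> space M"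
    using assms(1) by (auto simp: G)
  also have "\<dots> \<in> sets M" using assms(2)[OF B] A by (rule measurable_sets)
  finally show "f -` G \<inter> space M \<in> sets M" .
qed (use assms(1) in auto)

text \<open>The events described by finitely many counts form a generator of the \<open>\<sigma>\<close>-algebra that is
  closed under intersection, so they determine a finite measure on the space of point measures.\<close>

lemma Int_stable_finite_dimensional:
  "Int_stable {{\<eta> \<in> point_measure_set T. \<forall>i<n. emeasure \<eta> (B i) \<in> A i} | (n::nat) B A.
     \<forall>i<n. B i \<in> sets (mark_space T) \<and> A i \<in> sets borel}" (is "Int_stable ?E")
proof (rule Int_stableI)
  fix X Y assume "X \<in> ?E" "Y \<in> ?E"
  then obtain n m :: nat and B A B' A' where
    X: "X = {\<eta> \<in> point_measure_set T. \<forall>i<n. emeasure \<eta> (B i) \<in> A i}"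
      "\<forall>i<n. B i \<in> sets (mark_space T) \<and> A i \<in> sets borel" and
    Y: "Y = {\<eta> \<in> point_measure_set T. \<forall>i<m. emeasure \<eta> (B' i) \<in> A' i}"
      "\<forall>i<m. B' i \<in> sets (mark_space T) \<and> A' i \<in> sets borel"
    by blast
  define B'' where "B'' i = (if i < n then B i else B' (i - n))" for i
  define A'' where "A'' i = (if i < n then A i else A' (i - n))" for i
  have all: "(\<forall>i<n + m. R i) \<longleftrightarrow> (\<forall>i<n. R i) \<and> (\<forall>i<m. R (n + i))" for R
  proof (intro iffI allI impI conjI)
    fix i assume R: "(\<forall>i<n. R i) \<and> (\<forall>i<m. R (n + i))" and i: "i < n + m"
    show "R i"
    proof (cases "i < n")
      case False
      then have "i - n < m" using i by simp
      with R have "R (n + (i - n))" by blast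
      with False show ?thesis by simp
    qed (use R in blast)
  qed auto
  have "X \<inter> Y = {\<eta> \<in> point_measure_set T. \<forall>i<n + m. emeasure \<eta> (B'' i) \<in> A'' i}"
    unfolding all X Y by (auto simp: B''_def A''_def)
  moreover have "\<forall>i<n + m. B'' i \<in> sets (mark_space T) \<and> A'' i \<in> sets borel"
    unfolding all using X(2) Y(2) by (auto simp: B''_def A''_def)
  ultimately show "X \<inter> Y \<in> ?E" by blast
qed

lemma sets_point_measures_finite_dim:
  "sets (point_measures T :: (real \<times> 'u::topological_space) measure measure) =
    sigma_sets (point_measure_set T)
     {{\<eta> \<in> point_measure_set T. \<forall>i<n. emeasure \<eta> (B i) \<in> A i} | (n::nat) B A.
      \<forall>i<n. B i \<in> sets (mark_space T) \<and> A i \<in> sets borel}" (is "_ = sigma_sets _ ?E")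
proof
  have "{\<eta> \<in> point_measure_set T. emeasure \<eta> B \<in> A} \<in> ?E"
    if "B \<in> sets (mark_space T)" "A \<in> sets borel" for B :: "(real \<times> 'u) set" and A
    using that by (intro CollectI exI[of _ "1::nat"] exI[of _ "\<lambda>_. B"] exI[of _ "\<lambda>_. A"]) auto
  then show "sets (point_measures T) \<subseteq> sigma_sets (point_measure_set T) ?E"
    unfolding sets_point_measures by (intro sigma_sets_mono') blast
next
  have "{\<eta> \<in> point_measure_set T. \<forall>i<n. emeasure \<eta> (B i) \<in> A i} \<in> sets (point_measures T)"
    if BA: "\<forall>i<n. B i \<in> sets (mark_space T) \<and> A i \<in> sets borel"
    for n :: nat and B :: "nat \<Rightarrow> (real \<times> 'u) set" and A
  proof -
    have ev: "{\<eta> \<in> space (point_measures T). emeasure \<eta> (B i) \<in> A i} \<in> sets (point_measures T)"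
      if "i \<in> {..<n}" for i
    proof -
      have "(\<lambda>\<eta>. emeasure \<eta> (B i)) -` A i \<inter> space (point_measures T) \<in> sets (point_measures T)"
        using BA that by (intro measurable_sets[OF measurable_emeasure_point_measures]) auto
      then show ?thesis by (simp only: vimage_def Int_def mem_Collect_eq conj_commute)
    qed
    have "{\<eta> \<in> space (point_measures T). \<forall>i\<in>{..<n}. emeasure \<eta> (B i) \<in> A i} \<in> sets (point_measures T)"
      by (rule sets.sets_Collect_finite_All[OF ev]) auto
    then show ?thesis unfolding space_point_measures Ball_def lessThan_iff .
  qed
  then have "?E \<subseteq> sets (point_measures T)" by blast
  then show "sigma_sets (point_measure_set T) ?E \<subseteq> sets (point_measures T)"
    using sets.sigma_sets_subset[of ?E "point_measures T"] by simp
qed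

context poisson_setting
begin

lemma measurable_N [measurable]: "N \<in> P \<rightarrow>\<^sub>M point_measures T"
  using N_poisson by (simp add: poisson_random_measure_def)

lemma N_in_point_measure_set: "\<omega> \<in> space P \<Longrightarrow> N \<omega> \<in> point_measure_set T"
  using measurable_space[OF measurable_N] by simp

lemma shift_in_point_measure_set: "\<omega> \<in> space P \<Longrightarrow> add_dirac (N \<omega>) z \<in> point_measure_set T"
  by (rule add_dirac_in_point_measure_set[OF N_in_point_measure_set])

lemma sets_N: "\<omega> \<in> space P \<Longrightarrow> sets (N \<omega>) = sets (mark_space T)"
  using N_in_point_measure_set by (simp add: point_measure_set_def)

lemma measurable_N_eval [measurable (raw)]:
  assumes "B \<in> sets (mark_space T)"
  shows "(\<lambda>\<omega>. emeasure (N \<omega>) B) \<in> borel_measurable P"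
  by (rule measurable_compose[OF measurable_N measurable_emeasure_point_measures[OF assms]])

lemma finite_measure_leb: "finite_measure (leb T)"
  by (rule finite_measureI)
    (simp add: leb_def space_restrict_space emeasure_restrict_space emeasure_lborel_Icc_eq)

sublocale leb: finite_measure "leb T"
  by (rule finite_measure_leb)

sublocale P_leb: pair_sigma_finite P "leb T" ..

sublocale full: pair_sigma_finite "P \<Otimes>\<^sub>M leb T" \<nu> ..

lemma space_nu: "space \<nu> = UNIV"
  using sets_eq_imp_space_eq[OF sets_nu] by simp

lemma space_full: "space (full_space T \<nu> P) = (space P \<times> {0..T}) \<times> UNIV"
  by (simp add: full_space_def space_pair_measure leb_def space_restrict_space space_nu)

lemma sets_mark: "sets (leb T \<Otimes>\<^sub>M \<nu>) = sets (mark_space T)"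
  by (rule sets_leb_pair[OF sets_nu])

lemma measurable_full_omega [measurable]: "(\<lambda>z. fst (fst z)) \<in> full_space T \<nu> P \<rightarrow>\<^sub>M P"
  unfolding full_space_def by measurable

lemma measurable_full_mark [measurable]:
  "(\<lambda>z. (snd (fst z), snd z)) \<in> full_space T \<nu> P \<rightarrow>\<^sub>M mark_space T"
proof -
  have "(\<lambda>z. (snd (fst z), snd z)) \<in> full_space T \<nu> P \<rightarrow>\<^sub>M leb T \<Otimes>\<^sub>M \<nu>"
    unfolding full_space_def by measurable
  then show ?thesis using measurable_cong_sets[OF refl sets_mark] by blast
qed

lemma measurable_shift [measurable]:
  "(\<lambda>z. add_dirac (N (fst (fst z))) (snd (fst z), snd z)) \<in> full_space T \<nu> P \<rightarrow>\<^sub>M point_measures T"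
proof (rule measurable_point_measuresI)
  fix z assume "z \<in> space (full_space T \<nu> P)"
  then show "add_dirac (N (fst (fst z))) (snd (fst z), snd z) \<in> point_measure_set T"
    by (intro add_dirac_in_point_measure_set N_in_point_measure_set) (auto simp: space_full)
next
  fix B :: "(real \<times> 'u) set" assume B [measurable]: "B \<in> sets (mark_space T)"
  have "(\<lambda>z. emeasure (N (fst (fst z))) B + indicator B (snd (fst z), snd z))
      \<in> borel_measurable (full_space T \<nu> P)"
    by measurable
  then show "(\<lambda>z. emeasure (add_dirac (N (fst (fst z))) (snd (fst z), snd z)) B)
      \<in> borel_measurable (full_space T \<nu> P)"
    by (rule measurable_cong[THEN iffD1, rotated])
      (use B sets_N in \<open>auto simp: emeasure_add_dirac space_full\<close>)
qed

text \<open>The triple product \<open>full_space\<close> nests \<open>\<Omega>\<close> with time, while the intensity lives on time and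
  marks. For products of a function of \<open>\<omega>\<close> and a set of marks the two ways of nesting agree
  by applying Tonelli's theorem twice.\<close>

lemma nn_integral_full_product:
  assumes [measurable]: "g \<in> borel_measurable P" and D: "D \<in> sets (mark_space T)"
  shows "(\<integral>\<^sup>+z. g (fst (fst z)) * indicator D (snd (fst z), snd z) \<partial>full_space T \<nu> P) =
    (\<integral>\<^sup>+\<omega>. g \<omega> \<partial>P) * emeasure (leb T \<Otimes>\<^sub>M \<nu>) D"
proof -
  have D' [measurable]: "D \<in> sets (leb T \<Otimes>\<^sub>M \<nu>)" using D by (simp add: sets_mark)
  have ind [measurable (raw)]: "(\<lambda>z. indicator D (f z) :: ennreal) \<in> borel_measurable M"
    if "f \<in> M \<rightarrow>\<^sub>M leb T \<Otimes>\<^sub>M \<nu>" for f and M :: "'c measure"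
    using that by (rule measurable_compose) measurable
  have "(\<integral>\<^sup>+z. g (fst (fst z)) * indicator D (snd (fst z), snd z) \<partial>full_space T \<nu> P) =
      (\<integral>\<^sup>+y. \<integral>\<^sup>+x. g (fst y) * indicator D (snd y, x) \<partial>\<nu> \<partial>(P \<Otimes>\<^sub>M leb T))"
    unfolding full_space_def by (subst nu.nn_integral_fst[symmetric], measurable)
  also have "\<dots> = (\<integral>\<^sup>+\<omega>. \<integral>\<^sup>+t. \<integral>\<^sup>+x. g \<omega> * indicator D (t, x) \<partial>\<nu> \<partial>leb T \<partial>P)"
    by (subst leb.nn_integral_fst[symmetric], measurable)
  also have "\<dots> = (\<integral>\<^sup>+\<omega>. g \<omega> * (\<integral>\<^sup>+t. \<integral>\<^sup>+x. indicator D (t, x) \<partial>\<nu> \<partial>leb T) \<partial>P)"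
  proof (intro nn_integral_cong)
    fix \<omega>
    have "(\<integral>\<^sup>+t. \<integral>\<^sup>+x. g \<omega> * indicator D (t, x) \<partial>\<nu> \<partial>leb T) =
        (\<integral>\<^sup>+t. g \<omega> * (\<integral>\<^sup>+x. indicator D (t, x) \<partial>\<nu>) \<partial>leb T)"
      by (intro nn_integral_cong nn_integral_cmult) measurable
    also have "\<dots> = g \<omega> * (\<integral>\<^sup>+t. \<integral>\<^sup>+x. indicator D (t, x) \<partial>\<nu> \<partial>leb T)"
      by (intro nn_integral_cmult) measurable
    finally show "(\<integral>\<^sup>+t. \<integral>\<^sup>+x. g \<omega> * indicator D (t, x) \<partial>\<nu> \<partial>leb T) =
        g \<omega> * (\<integral>\<^sup>+t. \<integral>\<^sup>+x. indicator D (t, x) \<partial>\<nu> \<partial>leb T)" .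
  qed
  also have "(\<integral>\<^sup>+t. \<integral>\<^sup>+x. indicator D (t, x) \<partial>\<nu> \<partial>leb T) = (\<integral>\<^sup>+z. indicator D z \<partial>(leb T \<Otimes>\<^sub>M \<nu>))"
    by (subst nu.nn_integral_fst[symmetric]) auto
  also have "\<dots> = emeasure (leb T \<Otimes>\<^sub>M \<nu>) D" by simp
  finally show ?thesis by (simp add: nn_integral_multc)
qed

section \<open>The Mecke equation\<close>

text \<open>By additivity in \<open>C\<close> the set \<open>C\<close> may be replaced by a cell \<open>D k\<close> of a common refinement of \<open>C\<close>
  and the sets \<open>B i\<close>. Adding a point of \<open>D k\<close> then raises exactly the count of \<open>D k\<close> by one,
  and this count is Poisson and independent of the counts of all other cells. As a part of \<open>C\<close> the
  cell \<open>D k\<close> has finite intensity; the other cells, which may have infinite intensity, enter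
  through independence alone.\<close>

lemma mecke_finite_dimensional:
  fixes B :: "nat \<Rightarrow> (real \<times> 'u) set"
  assumes BA: "\<And>i. i < n \<Longrightarrow> B i \<in> sets (mark_space T)" "\<And>i. i < n \<Longrightarrow> A i \<in> sets borel"
    and C: "C \<in> sets (mark_space T)" and C_fin: "emeasure (leb T \<Otimes>\<^sub>M \<nu>) C < \<infinity>"
  defines "\<Gamma> \<equiv> {\<eta> \<in> point_measure_set T. \<forall>i<n. emeasure \<eta> (B i) \<in> A i}"
  shows "(\<integral>\<^sup>+\<omega>. emeasure (N \<omega>) C * indicator \<Gamma> (N \<omega>) \<partial>P) =
    (\<integral>\<^sup>+z. indicator \<Gamma> (add_dirac (N (fst (fst z))) (snd (fst z), snd z)) *
      indicator C (snd (fst z), snd z) \<partial>full_space T \<nu> P)"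
proof -
  let ?\<mu> = "leb T \<Otimes>\<^sub>M \<nu>" and ?S = "\<lambda>z. add_dirac (N (fst (fst z))) (snd (fst z), snd z)"
  define B' where "B' i = (if i < n then B i else C)" for i
  have "B' i \<in> sets (mark_space T)" if "i < Suc n" for i
    using BA C that by (auto simp: B'_def)
  then obtain m :: nat and D S where D: "\<And>j. j < m \<Longrightarrow> D j \<in> sets (mark_space T)"
    and disj: "disjoint_family_on D {..<m}"
    and S: "\<And>i. i < Suc n \<Longrightarrow> S i \<subseteq> {..<m}" "\<And>i. i < Suc n \<Longrightarrow> B' i = (\<Union>j\<in>S i. D j)"
    using ex_disjoint_refinement[of "Suc n" B' "mark_space T"] by metis
  have S_fin: "finite (S i)" if "i < Suc n" for i
    using S(1)[OF that] by (rule finite_subset) simp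
  have S_disj: "disjoint_family_on D (S i)" if "i < Suc n" for i
    using disj S(1)[OF that] by (rule disjoint_family_on_mono[rotated])
  have S_less: "j < m" if "i < Suc n" "j \<in> S i" for i j
    using S(1)[OF that(1)] that(2) by auto
  have C_eq: "C = (\<Union>j\<in>S n. D j)" using S(2)[of n] by (simp add: B'_def)
  have B_eq: "B i = (\<Union>j\<in>S i. D j)" if "i < n" for i using S(2)[of i] that by (simp add: B'_def)
  have sum_eval: "emeasure \<eta> (\<Union>j\<in>S i. D j) = (\<Sum>j\<in>S i. emeasure \<eta> (D j))"
    if "i < Suc n" "sets \<eta> = sets (mark_space T)" for i and \<eta> :: "(real \<times> 'u) measure"
    using that S_less[of i] D S_fin S_disj by (intro sum_emeasure[symmetric]) auto
  have DD: "D i \<inter> D j = {}" if "i < m" "j < m" "i \<noteq> j" for i j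
    using disj that by (auto simp: disjoint_family_on_def)
  have \<Gamma>m [measurable]: "\<Gamma> \<in> sets (point_measures T)"
    unfolding sets_point_measures_finite_dim \<Gamma>_def
    by (rule sigma_sets.Basic) (use BA in blast)

  have cell: "(\<integral>\<^sup>+\<omega>. emeasure (N \<omega>) (D k) * indicator \<Gamma> (N \<omega>) \<partial>P) =
      (\<integral>\<^sup>+z. indicator \<Gamma> (?S z) * indicator (D k) (snd (fst z), snd z) \<partial>full_space T \<nu> P)"
    if k: "k \<in> S n" for k
  proof -
    have km: "k < m" using S_less[of n k] k by simp
    note Dk = D[OF km]
    have "emeasure ?\<mu> (D k) \<le> emeasure ?\<mu> C"
      using k C_eq C by (intro emeasure_mono) (auto simp: sets_mark)
    with C_fin have Dk_fin: "emeasure ?\<mu> (D k) < \<infinity>" by simp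
    \<comment> \<open>\<open>Q y \<omega>\<close> is the event \<open>N \<omega> \<in> \<Gamma>\<close> with the count of the cell \<open>D k\<close> replaced by \<open>y\<close>.\<close>
    define Q where "Q y \<omega> \<longleftrightarrow>
      (\<forall>i<n. (\<Sum>j\<in>S i. if j = k then y else emeasure (N \<omega>) (D j)) \<in> A i)" for y :: ennreal and \<omega>
    have meas: "(\<lambda>\<omega>. if j = k then y else emeasure (N \<omega>) (D j)) \<in> borel_measurable P"
      if "j < m" for j y
      using D[OF that] by (cases "j = k") (auto intro: measurable_N_eval)
    have Qm [measurable]: "Measurable.pred P (Q y)" for y
    proof -
      have "Measurable.pred P (\<lambda>\<omega>. \<forall>i\<in>{..<n}.
          (\<Sum>j\<in>S i. if j = k then y else emeasure (N \<omega>) (D j)) \<in> A i)"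
      proof (intro pred_intros_finite)
        fix i assume i: "i \<in> {..<n}"
        have "(\<lambda>\<omega>. \<Sum>j\<in>S i. if j = k then y else emeasure (N \<omega>) (D j)) \<in> borel_measurable P"
          using i S_less[of i] by (intro borel_measurable_sum meas) auto
        then show "Measurable.pred P (\<lambda>\<omega>. (\<Sum>j\<in>S i. if j = k then y else emeasure (N \<omega>) (D j)) \<in> A i)"
          using BA(2)[of i] i by (intro pred_sets2[of "A i" borel]) auto
      qed simp
      then show ?thesis unfolding Q_def Ball_def lessThan_iff .
    qed
    have Q_N: "N \<omega> \<in> \<Gamma> \<longleftrightarrow> Q (emeasure (N \<omega>) (D k)) \<omega>" if \<omega>: "\<omega> \<in> space P" for \<omega>
    proof -
      have "emeasure (N \<omega>) (B i) =
          (\<Sum>j\<in>S i. if j = k then emeasure (N \<omega>) (D k) else emeasure (N \<omega>) (D j))"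
        if "i < n" for i
        unfolding B_eq[OF that]
        by (subst sum_eval) (use that \<omega> sets_N in \<open>auto intro!: sum.cong\<close>)
      with N_in_point_measure_set[OF \<omega>] show ?thesis by (simp add: \<Gamma>_def Q_def)
    qed
    have Q_shift: "add_dirac (N \<omega>) x \<in> \<Gamma> \<longleftrightarrow> Q (emeasure (N \<omega>) (D k) + 1) \<omega>"
      if \<omega>: "\<omega> \<in> space P" and x: "x \<in> D k" for \<omega> x
    proof -
      have "emeasure (add_dirac (N \<omega>) x) (B i) =
          (\<Sum>j\<in>S i. if j = k then emeasure (N \<omega>) (D k) + 1 else emeasure (N \<omega>) (D j))"
        if i: "i < n" for i
        unfolding B_eq[OF i]
      proof (subst sum_eval)
        show "(\<Sum>j\<in>S i. emeasure (add_dirac (N \<omega>) x) (D j)) =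
          (\<Sum>j\<in>S i. if j = k then emeasure (N \<omega>) (D k) + 1 else emeasure (N \<omega>) (D j))"
        proof (intro sum.cong refl)
          fix j assume j: "j \<in> S i"
          then have jm: "j < m" using S_less[of i j] i by simp
          have "indicator (D j) x = (if j = k then 1 else 0 :: ennreal)"
            using DD[OF jm km] x by (auto simp: indicator_def)
          then show "emeasure (add_dirac (N \<omega>) x) (D j) =
            (if j = k then emeasure (N \<omega>) (D k) + 1 else emeasure (N \<omega>) (D j))"
            using D[OF jm] sets_N[OF \<omega>] by (simp add: emeasure_add_dirac)
        qed
      qed (use i \<omega> sets_N in auto)
      with add_dirac_in_point_measure_set[OF N_in_point_measure_set[OF \<omega>]]
      show ?thesis by (simp add: \<Gamma>_def Q_def)
    qed

    have indep: "prob {\<omega> \<in> space P. emeasure (N \<omega>) (D k) = of_nat l \<and> Q y \<omega>} =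
        prob {\<omega> \<in> space P. emeasure (N \<omega>) (D k) = of_nat l} * prob {\<omega> \<in> space P. Q y \<omega>}"
      for l :: nat and y
    proof -
      let ?X = "\<lambda>j \<omega>. emeasure (N \<omega>) (D j)" and ?R = "{..<m} - {k}"
      have "indep_vars (\<lambda>_. borel) ?X {..<m}"
        using N_poisson D disj by (simp add: poisson_random_measure_def)
      then have iv: "indep_var (Pi\<^sub>M {k} (\<lambda>_. borel)) (\<lambda>\<omega>. restrict (\<lambda>j. ?X j \<omega>) {k})
          (Pi\<^sub>M ?R (\<lambda>_. borel)) (\<lambda>\<omega>. restrict (\<lambda>j. ?X j \<omega>) ?R)"
        by (rule indep_var_restrict) (use km in auto)
      \<comment> \<open>Both factors are read off the family of counts: \<open>U\<close> from the coordinate \<open>k\<close>, \<open>V\<close> from all other coordinates.\<close>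
      define U where "U = {f \<in> space (Pi\<^sub>M {k} (\<lambda>_. borel :: ennreal measure)). f k = of_nat l}"
      define V where "V = {f \<in> space (Pi\<^sub>M ?R (\<lambda>_. borel :: ennreal measure)).
        \<forall>i\<in>{..<n}. (\<Sum>j\<in>S i. if j = k then y else f j) \<in> A i}"
      have U: "U \<in> sets (Pi\<^sub>M {k} (\<lambda>_. borel))" unfolding U_def by measurable
      have V: "V \<in> sets (Pi\<^sub>M ?R (\<lambda>_. borel))" unfolding V_def
      proof (rule sets.sets_Collect_finite_All)
        fix i assume i: "i \<in> {..<n}"
        have "(\<lambda>f. \<Sum>j\<in>S i. if j = k then y else f j)
            \<in> borel_measurable (Pi\<^sub>M ?R (\<lambda>_. borel :: ennreal measure))"
        proof (intro borel_measurable_sum)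
          fix j assume "j \<in> S i"
          then have "j = k \<or> j \<in> ?R" using S_less[of i j] i by auto
          then show "(\<lambda>f. if j = k then y else f j)
              \<in> borel_measurable (Pi\<^sub>M ?R (\<lambda>_. borel :: ennreal measure))"
            by (cases "j = k") auto
        qed
        from measurable_sets[OF this, of "A i"] BA(2)[of i] i
        show "{f \<in> space (Pi\<^sub>M ?R (\<lambda>_. borel :: ennreal measure)).
            (\<Sum>j\<in>S i. if j = k then y else f j) \<in> A i} \<in> sets (Pi\<^sub>M ?R (\<lambda>_. borel))"
          by (simp add: vimage_def Int_def conj_commute)
      qed simp
      have V_iff: "restrict (\<lambda>j. ?X j \<omega>) ?R \<in> V \<longleftrightarrow> Q y \<omega>" for \<omega>
      proof -
        have "(\<Sum>j\<in>S i. if j = k then y else restrict (\<lambda>j. ?X j \<omega>) ?R j) =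
            (\<Sum>j\<in>S i. if j = k then y else ?X j \<omega>)" if "i < n" for i
          using S_less[of i] that by (intro sum.cong) auto
        then show ?thesis by (auto simp: V_def Q_def space_PiM)
      qed
      have U_iff: "restrict (\<lambda>j. ?X j \<omega>) {k} \<in> U \<longleftrightarrow> ?X k \<omega> = of_nat l" for \<omega>
        by (auto simp: U_def space_PiM)
      show ?thesis
        using indep_varD[OF iv U V]
        by (simp add: vimage_def Int_def U_iff V_iff conj_commute)
    qed

    have "(\<integral>\<^sup>+\<omega>. emeasure (N \<omega>) (D k) * indicator \<Gamma> (N \<omega>) \<partial>P) =
        (\<integral>\<^sup>+\<omega>. emeasure (N \<omega>) (D k) * indicator {\<omega>. Q (emeasure (N \<omega>) (D k)) \<omega>} \<omega> \<partial>P)"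
      using Q_N by (intro nn_integral_cong) (simp add: indicator_def)
    also have "\<dots> = ennreal (measure ?\<mu> (D k)) *
        (\<integral>\<^sup>+\<omega>. indicator {\<omega>. Q (emeasure (N \<omega>) (D k) + 1) \<omega>} \<omega> \<partial>P)"
    proof (rule poisson_size_bias)
      show "prob {\<omega> \<in> space P. emeasure (N \<omega>) (D k) = of_nat l} =
          measure ?\<mu> (D k) ^ l / fact l * exp (- measure ?\<mu> (D k))" for l :: nat
        using N_poisson Dk Dk_fin by (simp add: poisson_random_measure_def)
    qed (use Dk indep in \<open>auto intro: measurable_N_eval\<close>)
    also have "ennreal (measure ?\<mu> (D k)) = emeasure ?\<mu> (D k)"
      using Dk_fin by (intro emeasure_eq_ennreal_measure[symmetric]) simp
    also have "(\<integral>\<^sup>+\<omega>. indicator {\<omega>. Q (emeasure (N \<omega>) (D k) + 1) \<omega>} \<omega> \<partial>P) =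
        (\<integral>\<^sup>+\<omega>. indicator {\<omega> \<in> space P. Q (emeasure (N \<omega>) (D k) + 1) \<omega>} \<omega> \<partial>P)"
      by (intro nn_integral_cong) (simp add: indicator_def)
    also have "emeasure ?\<mu> (D k) * \<dots> =
        (\<integral>\<^sup>+z. indicator {\<omega> \<in> space P. Q (emeasure (N \<omega>) (D k) + 1) \<omega>} (fst (fst z)) *
          indicator (D k) (snd (fst z), snd z) \<partial>full_space T \<nu> P)"
    proof (subst nn_integral_full_product)
      show "indicator {\<omega> \<in> space P. Q (emeasure (N \<omega>) (D k) + 1) \<omega>} \<in> borel_measurable P"
      proof (rule borel_measurable_indicator)
        have "{\<omega> \<in> space P. Q (emeasure (N \<omega>) (D k) + 1) \<omega>} =
            {\<omega> \<in> space P. \<forall>i\<in>{..<n}. (\<Sum>j\<in>S i. if j = k then emeasure (N \<omega>) (D k) + 1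
              else emeasure (N \<omega>) (D j)) \<in> A i}" by (auto simp: Q_def)
        also have "\<dots> \<in> sets P"
        proof (rule sets.sets_Collect_finite_All)
          fix i assume i: "i \<in> {..<n}"
          have "(\<lambda>\<omega>. \<Sum>j\<in>S i. if j = k then emeasure (N \<omega>) (D k) + 1 else emeasure (N \<omega>) (D j))
              \<in> borel_measurable P"
          proof (intro borel_measurable_sum)
            fix j assume "j \<in> S i"
            then have "j < m" using S_less[of i j] i by simp
            then show "(\<lambda>\<omega>. if j = k then emeasure (N \<omega>) (D k) + 1 else emeasure (N \<omega>) (D j))
              \<in> borel_measurable P"
              using D[of j] Dk by (cases "j = k") (auto intro: measurable_N_eval)
          qed
          from measurable_sets[OF this, of "A i"] BA(2)[of i] i
          show "{\<omega> \<in> space P. (\<Sum>j\<in>S i. if j = k then emeasure (N \<omega>) (D k) + 1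
              else emeasure (N \<omega>) (D j)) \<in> A i} \<in> sets P"
            by (simp add: vimage_def Int_def conj_commute)
        qed simp
        finally show "{\<omega> \<in> space P. Q (emeasure (N \<omega>) (D k) + 1) \<omega>} \<in> sets P" .
      qed
    qed (use Dk in \<open>simp_all add: mult.commute\<close>)
    also have "\<dots> = (\<integral>\<^sup>+z. indicator \<Gamma> (?S z) * indicator (D k) (snd (fst z), snd z) \<partial>full_space T \<nu> P)"
      using Q_shift by (intro nn_integral_cong) (auto simp: indicator_def space_full)
    finally show ?thesis .
  qed

  have "(\<integral>\<^sup>+\<omega>. emeasure (N \<omega>) C * indicator \<Gamma> (N \<omega>) \<partial>P) =
      (\<integral>\<^sup>+\<omega>. (\<Sum>k\<in>S n. emeasure (N \<omega>) (D k) * indicator \<Gamma> (N \<omega>)) \<partial>P)"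
    unfolding C_eq
    by (intro nn_integral_cong, subst sum_eval) (use sets_N in \<open>auto simp: sum_distrib_right\<close>)
  also have "\<dots> = (\<Sum>k\<in>S n. \<integral>\<^sup>+\<omega>. emeasure (N \<omega>) (D k) * indicator \<Gamma> (N \<omega>) \<partial>P)"
    using S_less[of n] D by (intro nn_integral_sum) (auto intro!: borel_measurable_times measurable_N_eval)
  also have "\<dots> = (\<Sum>k\<in>S n. \<integral>\<^sup>+z. indicator \<Gamma> (?S z) *
      indicator (D k) (snd (fst z), snd z) \<partial>full_space T \<nu> P)"
    by (intro sum.cong refl cell)
  also have "\<dots> = (\<integral>\<^sup>+z. (\<Sum>k\<in>S n. indicator \<Gamma> (?S z) *
      indicator (D k) (snd (fst z), snd z)) \<partial>full_space T \<nu> P)"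
  proof (rule nn_integral_sum[symmetric])
    fix k assume "k \<in> S n"
    then have [measurable]: "D k \<in> sets (mark_space T)" using S_less[of n k] D by auto
    show "(\<lambda>z. indicator \<Gamma> (?S z) * indicator (D k) (snd (fst z), snd z) :: ennreal)
        \<in> borel_measurable (full_space T \<nu> P)"
      by measurable
  qed
  also have "\<dots> = (\<integral>\<^sup>+z. indicator \<Gamma> (?S z) * indicator C (snd (fst z), snd z) \<partial>full_space T \<nu> P)"
    unfolding C_eq
    by (intro nn_integral_cong, subst indicator_UN_disjoint)
      (use S_fin S_disj in \<open>auto simp: sum_distrib_left\<close>)
  finally show ?thesis .
qed

text \<open>The Mecke equation for the certain event says that the expected number of points in \<open>C\<close> is the
  intensity of \<open>C\<close>.\<close>

lemma N_finite_AE: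
  assumes "C \<in> sets (mark_space T)" "emeasure (leb T \<Otimes>\<^sub>M \<nu>) C < \<infinity>"
  shows "AE \<omega> in P. emeasure (N \<omega>) C < \<infinity>"
proof -
  have "(\<integral>\<^sup>+\<omega>. emeasure (N \<omega>) C \<partial>P) = emeasure (leb T \<Otimes>\<^sub>M \<nu>) C"
  proof -
    have "(\<integral>\<^sup>+\<omega>. emeasure (N \<omega>) C \<partial>P) =
        (\<integral>\<^sup>+\<omega>. emeasure (N \<omega>) C * indicator {\<eta> \<in> point_measure_set T. True} (N \<omega>) \<partial>P)"
      using N_in_point_measure_set by (intro nn_integral_cong) simp
    also have "\<dots> = (\<integral>\<^sup>+z. indicator {\<eta> \<in> point_measure_set T. True}
        (add_dirac (N (fst (fst z))) (snd (fst z), snd z)) *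
        indicator C (snd (fst z), snd z) \<partial>full_space T \<nu> P)"
      \<comment> \<open>No count is prescribed, so the finite-dimensional event is the whole space.\<close>
      using mecke_finite_dimensional[of 0 _ _ C] assms by simp
    also have "\<dots> = (\<integral>\<^sup>+z. 1 * indicator C (snd (fst z), snd z) \<partial>full_space T \<nu> P)"
      by (intro nn_integral_cong)
        (auto simp: space_full indicator_def shift_in_point_measure_set)
    also have "\<dots> = emeasure (leb T \<Otimes>\<^sub>M \<nu>) C"
      using nn_integral_full_product[of "\<lambda>_. 1" C] assms by (simp add: emeasure_space_1)
    finally show ?thesis .
  qed
  then have "(\<integral>\<^sup>+\<omega>. emeasure (N \<omega>) C \<partial>P) \<noteq> \<infinity>" using assms(2) by simp
  from nn_integral_PInf_AE[OF measurable_N_eval[OF assms(1)] this]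
  show ?thesis by (simp add: top.not_eq_extremum)
qed

text \<open>Stated as an equality of image measures, the Mecke equation yields integrability and the values of
  integrals at once, for functions of either sign. Both measures have total mass
  \<open>\<mu>(C) < \<infinity>\<close>, so their agreement on finite-dimensional events suffices.\<close>

lemma mecke:
  assumes C [measurable]: "C \<in> sets (mark_space T)" and C_fin: "emeasure (leb T \<Otimes>\<^sub>M \<nu>) C < \<infinity>"
  shows "distr (density P (\<lambda>\<omega>. emeasure (N \<omega>) C)) (point_measures T) N =
    distr (density (full_space T \<nu> P) (\<lambda>z. indicator C (snd (fst z), snd z)))
      (point_measures T) (\<lambda>z. add_dirac (N (fst (fst z))) (snd (fst z), snd z))" (is "?L = ?R")
proof (rule measure_eqI_generator_eq[OF Int_stable_finite_dimensional])
  let ?E = "{{\<eta> \<in> point_measure_set T. \<forall>i<n. emeasure \<eta> (B i) \<in> A i} | (n::nat) B A.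
     \<forall>i<n. B i \<in> sets (mark_space T) \<and> A i \<in> sets borel} :: (real \<times> 'u) measure set set"
  have em_L: "emeasure ?L G = (\<integral>\<^sup>+\<omega>. emeasure (N \<omega>) C * indicator G (N \<omega>) \<partial>P)"
    if [measurable]: "G \<in> sets (point_measures T)" for G
  proof -
    have "emeasure ?L G = emeasure (density P (\<lambda>\<omega>. emeasure (N \<omega>) C)) (N -` G \<inter> space P)"
      by (subst emeasure_distr) auto
    also have "\<dots> = (\<integral>\<^sup>+\<omega>. emeasure (N \<omega>) C * indicator (N -` G \<inter> space P) \<omega> \<partial>P)"
      by (rule emeasure_density) measurable
    also have "\<dots> = (\<integral>\<^sup>+\<omega>. emeasure (N \<omega>) C * indicator G (N \<omega>) \<partial>P)"
      by (intro nn_integral_cong) (simp add: indicator_def)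
    finally show ?thesis .
  qed
  let ?S = "\<lambda>z. add_dirac (N (fst (fst z))) (snd (fst z), snd z)"
  have em_R: "emeasure ?R G = (\<integral>\<^sup>+z. indicator G (?S z) * indicator C (snd (fst z), snd z)
      \<partial>full_space T \<nu> P)" if [measurable]: "G \<in> sets (point_measures T)" for G
  proof -
    have "emeasure ?R G = emeasure (density (full_space T \<nu> P) (\<lambda>z. indicator C (snd (fst z), snd z)))
        (?S -` G \<inter> space (full_space T \<nu> P))"
      by (subst emeasure_distr) auto
    also have "\<dots> = (\<integral>\<^sup>+z. indicator C (snd (fst z), snd z) *
        indicator (?S -` G \<inter> space (full_space T \<nu> P)) z \<partial>full_space T \<nu> P)"
      by (rule emeasure_density) measurable
    also have "\<dots> = (\<integral>\<^sup>+z. indicator G (?S z) * indicator C (snd (fst z), snd z)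
      \<partial>full_space T \<nu> P)"
      by (intro nn_integral_cong) (simp add: indicator_def)
    finally show ?thesis .
  qed
  have E_sub: "?E \<subseteq> sets (point_measures T)"
    unfolding sets_point_measures_finite_dim by (rule sigma_sets_superset_generator)
  show eq: "emeasure ?L G = emeasure ?R G" if GE: "G \<in> ?E" for G
  proof -
    have G: "G \<in> sets (point_measures T)" by (rule subsetD[OF E_sub GE])
    obtain n :: nat and B A where BA: "G = {\<eta> \<in> point_measure_set T. \<forall>i<n. emeasure \<eta> (B i) \<in> A i}"
      "\<forall>i<n. B i \<in> sets (mark_space T) \<and> A i \<in> sets borel"
      using GE by blast
    show ?thesis
      unfolding em_L[OF G] em_R[OF G]
      unfolding BA(1) using BA(2)
      by (intro mecke_finite_dimensional C C_fin) auto
  qed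
  show "?E \<subseteq> Pow (point_measure_set T)" by blast
  show "sets ?L = sigma_sets (point_measure_set T) ?E" "sets ?R = sigma_sets (point_measure_set T) ?E"
    by (simp_all add: sets_point_measures_finite_dim)
  have top: "point_measure_set T \<in> ?E"
    by (rule CollectI, rule exI[of _ 0]) auto
  then show "range (\<lambda>_::nat. point_measure_set T) \<subseteq> ?E" by blast
  show "(\<Union>i::nat. point_measure_set T) = point_measure_set T" by simp
  have "emeasure ?R (point_measure_set T) \<le>
      (\<integral>\<^sup>+z. 1 * indicator C (snd (fst z), snd z) \<partial>full_space T \<nu> P)"
    unfolding em_R[OF subsetD[OF E_sub top]]
    by (intro nn_integral_mono mult_right_mono) (auto simp: indicator_def)
  also have "\<dots> = emeasure (leb T \<Otimes>\<^sub>M \<nu>) C"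
    using nn_integral_full_product[of "\<lambda>_. 1" C] C by (simp add: emeasure_space_1)
  finally show "emeasure ?L (point_measure_set T) \<noteq> \<infinity>"
    using C_fin eq[OF top] by (auto simp: top_unique)
qed

section \<open>Duality for the indicator of a rectangle\<close>

lemma ennreal_of_indicator: "ennreal (indicator D z) = indicator D z"
  by (simp add: indicator_def)

text \<open>Time and marks are integrated out, which leaves only the intensity of \<open>D\<close>. This transfers null sets and integrals from \<open>P\<close> to the product space.\<close>

lemma distr_full_omega:
  assumes D [measurable]: "D \<in> sets (mark_space T)"
  shows "distr (density (full_space T \<nu> P) (\<lambda>z. indicator D (snd (fst z), snd z))) P
      (\<lambda>z. fst (fst z)) = density P (\<lambda>_. emeasure (leb T \<Otimes>\<^sub>M \<nu>) D)" (is "?L = ?R")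
proof (rule measure_eqI)
  fix A assume "A \<in> sets ?L"
  then have A [measurable]: "A \<in> sets P" by simp
  have "emeasure ?L A = emeasure (density (full_space T \<nu> P) (\<lambda>z. indicator D (snd (fst z), snd z)))
      ((\<lambda>z. fst (fst z)) -` A \<inter> space (full_space T \<nu> P))"
    by (subst emeasure_distr) auto
  also have "\<dots> = (\<integral>\<^sup>+z. indicator D (snd (fst z), snd z) *
      indicator ((\<lambda>z. fst (fst z)) -` A \<inter> space (full_space T \<nu> P)) z \<partial>full_space T \<nu> P)"
    by (rule emeasure_density) measurable
  also have "\<dots> = (\<integral>\<^sup>+z. indicator A (fst (fst z)) * indicator D (snd (fst z), snd z) \<partial>full_space T \<nu> P)"
    by (intro nn_integral_cong) (simp add: indicator_def)
  also have "\<dots> = emeasure P A * emeasure (leb T \<Otimes>\<^sub>M \<nu>) D"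
    by (subst nn_integral_full_product) auto
  also have "\<dots> = emeasure ?R A"
    by (simp add: emeasure_density_const mult.commute)
  finally show "emeasure ?L A = emeasure ?R A" .
qed simp

lemma AE_full_omega:
  assumes "AE \<omega> in P. Q \<omega>"
  shows "AE z in full_space T \<nu> P. Q (fst (fst z))"
proof -
  let ?D = "space (mark_space T) :: (real \<times> 'u) set"
  have "AE z in density (full_space T \<nu> P) (\<lambda>z. indicator ?D (snd (fst z), snd z)). Q (fst (fst z))"
  proof (rule AE_distrD[of _ _ P])
    show "AE \<omega> in distr (density (full_space T \<nu> P) (\<lambda>z. indicator ?D (snd (fst z), snd z))) P
        (\<lambda>z. fst (fst z)). Q \<omega>"
      unfolding distr_full_omega[OF sets.top] using assms by (subst AE_density) auto
  qed simp
  then have "AE z in full_space T \<nu> P. (0::ennreal) < indicator ?D (snd (fst z), snd z) \<longrightarrow> Q (fst (fst z))"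
    by (subst (asm) AE_density) auto
  then show ?thesis
    using AE_space
    by eventually_elim (auto simp: space_full mark_space_def space_restrict_space)
qed

lemma
  assumes D [measurable]: "D \<in> sets (mark_space T)" and fin: "emeasure (leb T \<Otimes>\<^sub>M \<nu>) D < \<infinity>"
    and g: "integrable P (g :: 'w \<Rightarrow> real)"
  shows integrable_full_product:
      "integrable (full_space T \<nu> P) (\<lambda>z. indicator D (snd (fst z), snd z) * g (fst (fst z)))"
    and integral_full_product:
      "(LINT z|full_space T \<nu> P. indicator D (snd (fst z), snd z) * g (fst (fst z))) =
        measure (leb T \<Otimes>\<^sub>M \<nu>) D * (LINT \<omega>|P. g \<omega>)"
proof -
  let ?m = "measure (leb T \<Otimes>\<^sub>M \<nu>) D"
  have [measurable]: "g \<in> borel_measurable P" using g by simp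
  have eq: "distr (density (full_space T \<nu> P) (\<lambda>z. ennreal (indicator D (snd (fst z), snd z)))) P
      (\<lambda>z. fst (fst z)) = density P (\<lambda>_. ennreal ?m)"
    using distr_full_omega[OF D] fin by (simp add: emeasure_eq_ennreal_measure ennreal_of_indicator)
  have "integrable (density P (\<lambda>_. ennreal ?m)) g"
    using g by (subst integrable_density) auto
  then have "integrable (density (full_space T \<nu> P)
      (\<lambda>z. ennreal (indicator D (snd (fst z), snd z)))) (\<lambda>z. g (fst (fst z)))"
    unfolding eq[symmetric] by (rule integrable_distr[rotated]) simp
  then show "integrable (full_space T \<nu> P) (\<lambda>z. indicator D (snd (fst z), snd z) * g (fst (fst z)))"
    by (subst (asm) integrable_density) auto
  have "(LINT z|full_space T \<nu> P. indicator D (snd (fst z), snd z) * g (fst (fst z))) =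
      (LINT z|density (full_space T \<nu> P) (\<lambda>z. ennreal (indicator D (snd (fst z), snd z))). g (fst (fst z)))"
    by (subst integral_density) auto
  also have "\<dots> = (LINT \<omega>|density P (\<lambda>_. ennreal ?m). g \<omega>)"
    unfolding eq[symmetric] by (rule integral_distr[symmetric]) auto
  also have "\<dots> = ?m * (LINT \<omega>|P. g \<omega>)"
    by (subst integral_density) auto
  finally show "(LINT z|full_space T \<nu> P. indicator D (snd (fst z), snd z) * g (fst (fst z))) =
        ?m * (LINT \<omega>|P. g \<omega>)" .
qed

lemma
  fixes g :: "(real \<times> 'u) measure \<Rightarrow> real"
  assumes g [measurable]: "g \<in> borel_measurable (point_measures T)"
    and C [measurable]: "C \<in> sets (mark_space T)" and fin: "emeasure (leb T \<Otimes>\<^sub>M \<nu>) C < \<infinity>"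
    and int: "integrable (full_space T \<nu> P)
      (\<lambda>z. indicator C (snd (fst z), snd z) * g (add_dirac (N (fst (fst z))) (snd (fst z), snd z)))"
  shows integrable_mecke: "integrable P (\<lambda>\<omega>. measure (N \<omega>) C * g (N \<omega>))"
    and integral_mecke: "(LINT \<omega>|P. measure (N \<omega>) C * g (N \<omega>)) =
      (LINT z|full_space T \<nu> P. indicator C (snd (fst z), snd z) *
        g (add_dirac (N (fst (fst z))) (snd (fst z), snd z)))"
proof -
  let ?S = "\<lambda>z. add_dirac (N (fst (fst z))) (snd (fst z), snd z)"
  have [measurable]: "(\<lambda>\<omega>. measure (N \<omega>) C) \<in> borel_measurable P"
    unfolding measure_def by measurable
  have "density P (\<lambda>\<omega>. emeasure (N \<omega>) C) = density P (\<lambda>\<omega>. ennreal (measure (N \<omega>) C))"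
  proof (rule density_cong)
    show "AE \<omega> in P. emeasure (N \<omega>) C = ennreal (measure (N \<omega>) C)"
      using N_finite_AE[OF C fin] by eventually_elim (simp add: emeasure_eq_ennreal_measure)
  qed measurable
  then have eq: "distr (density P (\<lambda>\<omega>. ennreal (measure (N \<omega>) C))) (point_measures T) N =
    distr (density (full_space T \<nu> P) (\<lambda>z. ennreal (indicator C (snd (fst z), snd z))))
      (point_measures T) ?S"
    using mecke[OF C fin] by (simp add: ennreal_of_indicator)
  have "integrable (distr (density (full_space T \<nu> P)
      (\<lambda>z. ennreal (indicator C (snd (fst z), snd z)))) (point_measures T) ?S) g"
    using int by (subst integrable_distr_eq) (auto simp: integrable_density)
  then show "integrable P (\<lambda>\<omega>. measure (N \<omega>) C * g (N \<omega>))"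
    unfolding eq[symmetric] by (subst (asm) integrable_distr_eq) (auto simp: integrable_density)
  have "(LINT \<omega>|P. measure (N \<omega>) C * g (N \<omega>)) =
      (LINT \<omega>|density P (\<lambda>\<omega>. ennreal (measure (N \<omega>) C)). g (N \<omega>))"
    by (subst integral_density) auto
  also have "\<dots> = (LINT \<eta>|distr (density P (\<lambda>\<omega>. ennreal (measure (N \<omega>) C))) (point_measures T) N. g \<eta>)"
    by (subst integral_distr) auto
  also have "\<dots> = (LINT z|density (full_space T \<nu> P)
      (\<lambda>z. ennreal (indicator C (snd (fst z), snd z))). g (?S z))"
    unfolding eq by (subst integral_distr) auto
  also have "\<dots> = (LINT z|full_space T \<nu> P. indicator C (snd (fst z), snd z) * g (?S z))"
    by (subst integral_density) auto
  finally show "(LINT \<omega>|P. measure (N \<omega>) C * g (N \<omega>)) =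
      (LINT z|full_space T \<nu> P. indicator C (snd (fst z), snd z) * g (?S z))" .
qed

text \<open>Events of the history up to \<open>u\<close> are determined, up to a null set, by the restriction of \<open>N\<close> to
  \<open>[0,u] \<times> U\<close>, so an additional point after time \<open>u\<close> does not affect them. The null sets that
  are adjoined to the history are represented by \<open>\<Gamma> = {}\<close>.\<close>

lemma history_insensitive:
  assumes "A \<in> sets (history T P N u)"
  shows "\<exists>\<Gamma>\<in>sets (point_measures T). (AE \<omega> in P. \<omega> \<in> A \<longleftrightarrow> N \<omega> \<in> \<Gamma>) \<and>
    (\<forall>\<eta>\<in>point_measure_set T. \<forall>t x. u < t \<longrightarrow> (add_dirac \<eta> (t, x) \<in> \<Gamma> \<longleftrightarrow> \<eta> \<in> \<Gamma>))"
proof -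
  let ?G = "{{\<omega> \<in> space P. emeasure (N \<omega>) (({0..u} \<times> UNIV) \<inter> B) \<in> A} | B A.
         B \<in> sets (mark_space T) \<and> A \<in> sets borel} \<union> null_sets P"
  have "?G \<subseteq> Pow (space P)" using sets.sets_into_space by fastforce
  then have "A \<in> sigma_sets (space P) ?G"
    using assms by (simp add: history_def)
  then show ?thesis
  proof induction
    case (Basic a)
    then consider B A where "B \<in> sets (mark_space T)" "A \<in> sets borel"
        "a = {\<omega> \<in> space P. emeasure (N \<omega>) (({0..u} \<times> UNIV) \<inter> B) \<in> A}"
      | "a \<in> null_sets P" by blast
    then show ?case
    proof cases
      case 1
      let ?B = "({0..u} \<times> UNIV) \<inter> B"
      define \<Gamma> where "\<Gamma> = {\<eta> \<in> point_measure_set T. emeasure \<eta> ?B \<in> A}"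
      have "?B \<in> sets (mark_space T)"
      proof -
        have "{0..u} \<times> (UNIV::'u set) \<in> sets borel" by (intro borel_closed closed_Times) auto
        moreover have "{0..T} \<times> (UNIV::'u set) \<in> sets borel" by (intro borel_closed closed_Times) auto
        ultimately show ?thesis
          using 1 by (auto simp: mark_space_def sets_restrict_space_iff)
      qed
      note B = this
      show ?thesis
      proof (intro bexI[of _ \<Gamma>] conjI ballI allI impI)
        show "\<Gamma> \<in> sets (point_measures T)"
          unfolding \<Gamma>_def sets_point_measures by (rule sigma_sets.Basic) (use B 1 in blast)
        show "AE \<omega> in P. \<omega> \<in> a \<longleftrightarrow> N \<omega> \<in> \<Gamma>"
          using AE_space by eventually_elim (auto simp: \<Gamma>_def 1 N_in_point_measure_set)
      next
        fix \<eta> :: "(real \<times> 'u) measure" and t x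
        assume \<eta>: "\<eta> \<in> point_measure_set T" and t: "u < t"
        then have "?B \<in> sets \<eta>" using B by (simp add: point_measure_set_def)
        then have "emeasure (add_dirac \<eta> (t, x)) ?B = emeasure \<eta> ?B"
          using t by (simp add: emeasure_add_dirac)
        then show "add_dirac \<eta> (t, x) \<in> \<Gamma> \<longleftrightarrow> \<eta> \<in> \<Gamma>"
          using \<eta> add_dirac_in_point_measure_set[OF \<eta>, of "(t, x)"] by (simp add: \<Gamma>_def)
      qed
    next
      case 2
      from AE_not_in[OF this] show ?thesis
        by (intro bexI[of _ "{}"]) auto
    qed
  next
    case Empty
    show ?case by (intro bexI[of _ "{}"]) auto
  next
    case (Compl a)
    then obtain \<Gamma> where \<Gamma>: "\<Gamma> \<in> sets (point_measures T)" "AE \<omega> in P. \<omega> \<in> a \<longleftrightarrow> N \<omega> \<in> \<Gamma>"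
      "\<forall>\<eta>\<in>point_measure_set T. \<forall>t x. u < t \<longrightarrow> (add_dirac \<eta> (t, x) \<in> \<Gamma> \<longleftrightarrow> \<eta> \<in> \<Gamma>)" by blast
    show ?case
    proof (intro bexI[of _ "point_measure_set T - \<Gamma>"] conjI ballI allI impI)
      show "AE \<omega> in P. \<omega> \<in> space P - a \<longleftrightarrow> N \<omega> \<in> point_measure_set T - \<Gamma>"
        using \<Gamma>(2) AE_space by eventually_elim (auto simp: N_in_point_measure_set)
      show "point_measure_set T - \<Gamma> \<in> sets (point_measures T)"
        using sets.compl_sets[OF \<Gamma>(1)] by simp
    next
      fix \<eta> :: "(real \<times> 'u) measure" and t x
      assume \<eta>: "\<eta> \<in> point_measure_set T" and t: "u < t"
      show "add_dirac \<eta> (t, x) \<in> point_measure_set T - \<Gamma> \<longleftrightarrow> \<eta> \<in> point_measure_set T - \<Gamma>"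
        using \<Gamma>(3) \<eta> t add_dirac_in_point_measure_set[OF \<eta>, of "(t, x)"] by simp
    qed
  next
    case (Union a)
    define R where "R a \<Gamma> \<longleftrightarrow> \<Gamma> \<in> sets (point_measures T) \<and> (AE \<omega> in P. \<omega> \<in> a \<longleftrightarrow> N \<omega> \<in> \<Gamma>) \<and>
      (\<forall>\<eta>\<in>point_measure_set T. \<forall>t x. u < t \<longrightarrow> (add_dirac \<eta> (t, x) \<in> \<Gamma> \<longleftrightarrow> \<eta> \<in> \<Gamma>))" for a \<Gamma>
    have "\<exists>\<Gamma>. R (a i) \<Gamma>" for i
      using Union.IH[of i] unfolding R_def Bex_def .
    then obtain \<Gamma> where R: "\<And>i. R (a i) (\<Gamma> i)" by metis
    note R' = R[unfolded R_def]
    note \<Gamma> = R'[THEN conjunct1] R'[THEN conjunct2, THEN conjunct1] R'[THEN conjunct2, THEN conjunct2]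
    show ?case
    proof (intro bexI[of _ "\<Union>i. \<Gamma> i"] conjI ballI allI impI)
      have "AE \<omega> in P. \<forall>i. \<omega> \<in> a i \<longleftrightarrow> N \<omega> \<in> \<Gamma> i" using \<Gamma>(2) by (simp add: AE_all_countable)
      then show "AE \<omega> in P. \<omega> \<in> (\<Union>i. a i) \<longleftrightarrow> N \<omega> \<in> (\<Union>i. \<Gamma> i)"
        by eventually_elim auto
    qed (use \<Gamma> in auto)
  qed
qed

lemma rectangle_mark:
  assumes "0 \<le> u" "s \<le> T" "b \<in> sets borel" "emeasure \<nu> b < \<infinity>"
  shows "{u<..s} \<times> b \<in> sets (mark_space T)" "emeasure (leb T \<Otimes>\<^sub>M \<nu>) ({u<..s} \<times> b) < \<infinity>"
proof -
  have 1: "{u<..s} \<in> sets (leb T)" using assms by (auto simp: leb_def sets_restrict_space_iff)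
  have 2: "b \<in> sets \<nu>" using assms sets_nu by simp
  have 3: "emeasure (leb T) {u<..s} < \<top>" by (simp add: less_top[symmetric])
  show "{u<..s} \<times> b \<in> sets (mark_space T)"
    using 1 2 unfolding sets_mark[symmetric] by (rule pair_measureI)
  show "emeasure (leb T \<Otimes>\<^sub>M \<nu>) ({u<..s} \<times> b) < \<infinity>"
    unfolding nu.emeasure_pair_measure_Times[OF 1 2]
    using assms 3 by (simp add: ennreal_mult_less_top)
qed

text \<open>The Mecke equation is applied to \<open>g = 1\<^sub>\<Gamma> f\<close>, where \<open>\<Gamma>\<close> represents the event \<open>A\<close> and satisfies
  \<open>N + \<delta>\<^sub>z \<in> \<Gamma> \<longleftrightarrow> N \<in> \<Gamma>\<close> for \<open>z \<in> C\<close>. The compensating term is Fubini's theorem for the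
  same \<open>g\<close>. Integrability of \<open>f(N + \<delta>\<^sub>z)\<close> on \<open>C\<close> is inherited from the difference and from \<open>f(N)\<close>.\<close>

lemma duality_rectangle:
  fixes f :: "(real \<times> 'u) measure \<Rightarrow> real"
  assumes f [measurable]: "f \<in> borel_measurable (point_measures T)"
    and A: "A \<in> sets (history T P N u)"
    and us: "0 \<le> u" "s \<le> T" and b: "b \<in> sets borel" "emeasure \<nu> b < \<infinity>"
  defines "C \<equiv> {u<..s} \<times> b"
  assumes int_f: "integrable P (\<lambda>\<omega>. f (N \<omega>))"
    and int_D: "integrable (full_space T \<nu> P) (\<lambda>z. indicator C (snd (fst z), snd z) *
      (f (add_dirac (N (fst (fst z))) (snd (fst z), snd z)) - f (N (fst (fst z)))))"
  shows "(LINT \<omega>|P. indicator A \<omega> * compensated T \<nu> N C \<omega> * f (N \<omega>)) =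
    (LINT z|full_space T \<nu> P. indicator A (fst (fst z)) * (indicator C (snd (fst z), snd z) *
      (f (add_dirac (N (fst (fst z))) (snd (fst z), snd z)) - f (N (fst (fst z))))))"
proof -
  let ?S = "\<lambda>z. add_dirac (N (fst (fst z))) (snd (fst z), snd z)"
  let ?c = "\<lambda>z. indicator C (snd (fst z), snd z) :: real"
  have C [measurable]: "C \<in> sets (mark_space T)" and fin: "emeasure (leb T \<Otimes>\<^sub>M \<nu>) C < \<infinity>"
    using rectangle_mark[OF us b] by (simp_all add: C_def)
  have [measurable]: "A \<in> sets P" using A subalgebra_history by (auto simp: subalgebra_def)
  have [measurable]: "(\<lambda>\<omega>. measure (N \<omega>) C) \<in> borel_measurable P"
    unfolding measure_def by measurable
  obtain \<Gamma> where \<Gamma> [measurable]: "\<Gamma> \<in> sets (point_measures T)" and AE_A: "AE \<omega> in P. \<omega> \<in> A \<longleftrightarrow> N \<omega> \<in> \<Gamma>"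
    and ins: "\<forall>\<eta>\<in>point_measure_set T. \<forall>t x. u < t \<longrightarrow> (add_dirac \<eta> (t, x) \<in> \<Gamma> \<longleftrightarrow> \<eta> \<in> \<Gamma>)"
    using history_insensitive[OF A] by blast
  define g where "g \<eta> = indicator \<Gamma> \<eta> * f \<eta>" for \<eta>
  have g [measurable]: "g \<in> borel_measurable (point_measures T)" unfolding g_def by measurable
  have AE_gN: "AE \<omega> in P. g (N \<omega>) = indicator A \<omega> * f (N \<omega>)"
    using AE_A by eventually_elim (simp add: g_def indicator_def)
  have AE_gS: "AE z in full_space T \<nu> P. ?c z * g (?S z) = indicator A (fst (fst z)) * (?c z * f (?S z))"
    using AE_full_omega[OF AE_A] AE_space
  proof eventually_elim
    case (elim z)
    then have "N (fst (fst z)) \<in> point_measure_set T"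
      by (intro N_in_point_measure_set) (auto simp: space_full)
    then have "snd (fst z) > u \<Longrightarrow> ?S z \<in> \<Gamma> \<longleftrightarrow> fst (fst z) \<in> A" using ins elim(1) by blast
    then show ?case by (auto simp: g_def C_def indicator_def)
  qed
  have int_gN: "integrable P (\<lambda>\<omega>. g (N \<omega>))"
    using int_f by (rule Bochner_Integration.integrable_bound) (auto simp: g_def indicator_def)
  note int_cN = integrable_full_product[OF C fin int_f]
  have int_cS: "integrable (full_space T \<nu> P) (\<lambda>z. ?c z * f (?S z))"
    using Bochner_Integration.integrable_add[OF int_D int_cN] by (simp add: algebra_simps)
  have int_gS: "integrable (full_space T \<nu> P) (\<lambda>z. ?c z * g (?S z))"
    using int_cS by (rule Bochner_Integration.integrable_bound) (auto simp: g_def indicator_def)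
  have int_A: "integrable (full_space T \<nu> P) (\<lambda>z. indicator A (fst (fst z)) * (?c z * f (?S z)))"
    using int_cS by (rule Bochner_Integration.integrable_bound) (auto simp: indicator_def)
  have int_A': "integrable (full_space T \<nu> P) (\<lambda>z. indicator A (fst (fst z)) * (?c z * f (N (fst (fst z)))))"
    using int_cN by (rule Bochner_Integration.integrable_bound) (auto simp: indicator_def)
  have "(LINT \<omega>|P. indicator A \<omega> * compensated T \<nu> N C \<omega> * f (N \<omega>)) =
      (LINT \<omega>|P. measure (N \<omega>) C * g (N \<omega>) - measure (leb T \<Otimes>\<^sub>M \<nu>) C * g (N \<omega>))"
  proof (rule integral_cong_AE)
    show "AE \<omega> in P. indicator A \<omega> * compensated T \<nu> N C \<omega> * f (N \<omega>) =
        measure (N \<omega>) C * g (N \<omega>) - measure (leb T \<Otimes>\<^sub>M \<nu>) C * g (N \<omega>)"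
      using AE_gN by eventually_elim (simp add: compensated_def algebra_simps)
  qed (unfold compensated_def, measurable)
  also have "\<dots> = (LINT \<omega>|P. measure (N \<omega>) C * g (N \<omega>)) -
      measure (leb T \<Otimes>\<^sub>M \<nu>) C * (LINT \<omega>|P. g (N \<omega>))"
    using integrable_mecke[OF g C fin int_gS] int_gN by simp
  also have "\<dots> = (LINT z|full_space T \<nu> P. ?c z * g (?S z)) -
      (LINT z|full_space T \<nu> P. ?c z * g (N (fst (fst z))))"
    using integral_mecke[OF g C fin int_gS] integral_full_product[OF C fin int_gN] by simp
  also have "(LINT z|full_space T \<nu> P. ?c z * g (?S z)) =
      (LINT z|full_space T \<nu> P. indicator A (fst (fst z)) * (?c z * f (?S z)))"
    by (rule integral_cong_AE) (use AE_gS in auto)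
  also have "(LINT z|full_space T \<nu> P. ?c z * g (N (fst (fst z)))) =
      (LINT z|full_space T \<nu> P. indicator A (fst (fst z)) * (?c z * f (N (fst (fst z)))))"
  proof (rule integral_cong_AE)
    show "AE z in full_space T \<nu> P. ?c z * g (N (fst (fst z))) =
        indicator A (fst (fst z)) * (?c z * f (N (fst (fst z))))"
      using AE_full_omega[OF AE_gN] by eventually_elim simp
  qed measurable
  finally show ?thesis
    using int_A int_A' by (simp add: right_diff_distrib)
qed

section \<open>The predictable rectangles\<close>

lemma space_history: "space (history T P N u) = space P"
  using subalgebra_history[of u] by (simp add: subalgebra_def)

lemma sets_filtr_P: "A \<in> sets (filtr T P N r) \<Longrightarrow> A \<in> sets P"
  using subalgebra_filtr[of r] by (auto simp: subalgebra_def)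

lemma filtr_subset_space: "A \<in> sets (filtr T P N r) \<Longrightarrow> A \<subseteq> space P"
  by (rule sets.sets_into_space[OF sets_filtr_P])

text \<open>For \<open>r < T\<close> the intersection of the later histories is already a \<open>\<sigma>\<close>-algebra, so that
  generating one adds nothing.\<close>

lemma sets_filtr_iff:
  assumes r: "r < T"
  shows "A \<in> sets (filtr T P N r) \<longleftrightarrow> (\<forall>u\<in>{r<..T}. A \<in> sets (history T P N u))"
proof -
  let ?X = "\<Inter>u\<in>{r<..T}. sets (history T P N u)"
  have X: "?X \<subseteq> Pow (space P)"
  proof -
    have "?X \<subseteq> sets (history T P N T)" using r by (intro INF_lower) simp
    also have "\<dots> \<subseteq> Pow (space P)" using sets.space_closed[of "history T P N T"] by (simp add: space_history)
    finally show ?thesis .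
  qed
  have sets_eq: "sets (filtr T P N r) = sigma_sets (space P) ?X"
    unfolding filtr_def if_P[OF r] by (rule sets_measure_of[OF X])
  show ?thesis
  proof
    assume A: "A \<in> sets (filtr T P N r)"
    show "\<forall>u\<in>{r<..T}. A \<in> sets (history T P N u)"
    proof
      fix u assume "u \<in> {r<..T}"
      then have "?X \<subseteq> sets (history T P N u)" by blast
      from sets.sigma_sets_subset[OF this] A show "A \<in> sets (history T P N u)"
        by (auto simp: sets_eq space_history)
    qed
  next
    assume "\<forall>u\<in>{r<..T}. A \<in> sets (history T P N u)"
    then show "A \<in> sets (filtr T P N r)" unfolding sets_eq by (intro sigma_sets.Basic) blast
  qed
qed

lemma sets_filtr_mono:
  assumes A: "A \<in> sets (filtr T P N r)" and "r \<le> r'"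
  shows "A \<in> sets (filtr T P N r')"
proof (cases "r' < T")
  case True
  with assms show ?thesis by (auto simp: sets_filtr_iff)
next
  case False
  have "sets (filtr T P N r') = sets P"
    unfolding filtr_def using False by (simp add: sets.sigma_sets_eq)
  with sets_filtr_P[OF A] show ?thesis by simp
qed

text \<open>These sets generate the predictable \<open>\<sigma>\<close>-algebra, and they are closed under intersection because
  the filtration is increasing. The Dynkin argument below starts from them.\<close>

abbreviation pred_rectangles :: "('w \<times> real) set set" where
  "pred_rectangles \<equiv>
     {A \<times> {s<..t} | A s t. 0 \<le> s \<and> s < t \<and> t \<le> T \<and> A \<in> sets (filtr T P N s)} \<union>
     {A \<times> {0} | A. A \<in> sets (filtr T P N 0)}"

lemma pred_rectangles_subset: "pred_rectangles \<subseteq> Pow (space P \<times> {0..T})"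
proof
  fix R assume "R \<in> pred_rectangles"
  then show "R \<in> Pow (space P \<times> {0..T})"
    using filtr_subset_space T_pos by (elim UnE CollectE exE conjE) fastforce+
qed

lemma sets_predictable: "sets (predictable T P N) = sigma_sets (space P \<times> {0..T}) pred_rectangles"
  unfolding predictable_def by (rule sets_measure_of[OF pred_rectangles_subset])

lemma space_predictable: "space (predictable T P N) = space P \<times> {0..T}"
  unfolding predictable_def by (rule space_measure_of[OF pred_rectangles_subset])

lemma Int_stable_pred_rectangles: "Int_stable pred_rectangles"
proof (rule Int_stableI)
  fix R R' assume "R \<in> pred_rectangles" "R' \<in> pred_rectangles"
  \<comment> \<open>The empty set occurs as a rectangle with empty base, which covers disjoint time intervals.\<close>
  have empty: "{} \<in> pred_rectangles" by (rule UnI2) (intro CollectI exI[of _ "{}"], simp)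
  have mixed: "(A \<times> {s<..t}) \<inter> (A' \<times> {0}) = {}" if "0 \<le> s" for A A' :: "'w set" and s t :: real
    using that by auto
  from \<open>R \<in> pred_rectangles\<close> consider
      (int) A s t where "R = A \<times> {s<..t}" "0 \<le> s" "s < t" "t \<le> T" "A \<in> sets (filtr T P N s)"
    | (zero) A where "R = A \<times> {0}" "A \<in> sets (filtr T P N 0)" by blast
  note R = this
  from \<open>R' \<in> pred_rectangles\<close> consider
      (int) A s t where "R' = A \<times> {s<..t}" "0 \<le> s" "s < t" "t \<le> T" "A \<in> sets (filtr T P N s)"
    | (zero) A where "R' = A \<times> {0}" "A \<in> sets (filtr T P N 0)" by blast
  note R' = this
  show "R \<inter> R' \<in> pred_rectangles"
    using R
  proof cases
    case (int A s t)
    note 1 = this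
    from R' show ?thesis
    proof cases
      case (int A' s' t')
      have eq: "R \<inter> R' = (A \<inter> A') \<times> {max s s'<..min t t'}" using 1 int by auto
      show ?thesis
      proof (cases "max s s' < min t t'")
        case True
        have "A \<inter> A' \<in> sets (filtr T P N (max s s'))"
          using 1 int by (intro sets.Int) (auto intro: sets_filtr_mono)
        then show ?thesis unfolding eq
          by (intro UnI1 CollectI exI[of _ "A \<inter> A'"] exI[of _ "max s s'"] exI[of _ "min t t'"])
            (use 1 int True in auto)
      next
        case False
        then have "R \<inter> R' = {}" unfolding eq by auto
        then show ?thesis using empty by simp
      qed
    next
      case (zero A')
      then show ?thesis using 1 empty mixed by simp
    qed
  next
    case (zero A)
    note 1 = this
    from R' show ?thesis
    proof cases
      case (int A' s' t')
      then show ?thesis using 1 empty mixed by (simp add: Int_commute)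
    next
      case (zero A')
      have "R \<inter> R' = (A \<inter> A') \<times> {0}" using 1 zero by auto
      then show ?thesis
        by (intro UnI2 CollectI exI[of _ "A \<inter> A'"]) (use 1 zero in auto)
    qed
  qed
qed

lemma emeasure_full_slab:
  assumes "b \<in> sets borel" "emeasure \<nu> b < \<infinity>"
  shows "(space P \<times> {0..T}) \<times> b \<in> sets (full_space T \<nu> P)"
    "emeasure (full_space T \<nu> P) ((space P \<times> {0..T}) \<times> b) < \<infinity>"
proof -
  have sp: "space (leb T) = {0..T}" by (simp add: leb_def space_restrict_space)
  have 1: "{0..T} \<in> sets (leb T)" using sets.top[of "leb T"] by (simp only: sp)
  have 2: "space P \<times> {0..T} \<in> sets (P \<Otimes>\<^sub>M leb T)" using 1 by (intro pair_measureI) auto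
  have 3: "b \<in> sets \<nu>" using assms sets_nu by simp
  show "(space P \<times> {0..T}) \<times> b \<in> sets (full_space T \<nu> P)"
    unfolding full_space_def using 2 3 by (rule pair_measureI)
  have "emeasure (leb T) {0..T} < \<top>" by (simp add: less_top[symmetric])
  then show "emeasure (full_space T \<nu> P) ((space P \<times> {0..T}) \<times> b) < \<infinity>"
    unfolding full_space_def nu.emeasure_pair_measure_Times[OF 2 3]
      leb.emeasure_pair_measure_Times[OF sets.top 1] emeasure_space_1
    using assms by (simp add: ennreal_mult_less_top)
qed

lemma representative:
  fixes F :: "'w \<Rightarrow> 'h::{banach, second_countable_topology}"
  assumes "F \<in> borel_measurable P"
  shows "representative T P N F \<in> borel_measurable (point_measures T)"
    and "AE \<omega> in P. F \<omega> = representative T P N F (N \<omega>)"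
proof -
  have "\<exists>f. f \<in> borel_measurable (point_measures T) \<and> (AE \<omega> in P. F \<omega> = f (N \<omega>))"
    using ex_representative[OF assms] by blast
  from someI_ex[OF this]
  show "representative T P N F \<in> borel_measurable (point_measures T)"
    and "AE \<omega> in P. F \<omega> = representative T P N F (N \<omega>)"
    unfolding representative_def by blast+
qed

lemma diff_op_eq:
  "diff_op T P N F z = representative T P N F (add_dirac (N (fst (fst z))) (snd (fst z), snd z)) -
    representative T P N F (N (fst (fst z)))"
  by (simp add: diff_op_def case_prod_beta)

end

section \<open>Closure properties of the duality relation\<close>

text \<open>The data that stay fixed while the integrand \<open>\<Phi>\<close> runs through larger and larger classes.\<close>

locale duality_setting = poisson_setting P \<nu> T N
  for P :: "'w measure" and \<nu> :: "'u::{real_inner, banach, polish_space} measure"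
    and T :: real and N :: "'w \<Rightarrow> (real \<times> 'u) measure" +
  fixes p :: real and p' :: ennreal
    and I :: "(('w \<times> real) \<times> 'u \<Rightarrow> 'h::{real_inner, banach, polish_space}) \<Rightarrow> 'w \<Rightarrow> 'h"
    and F :: "'w \<Rightarrow> 'h" and B :: "'u set"
  assumes p: "1 \<le> p" and conj_exp: "1 / ennreal p + 1 / p' = 1"
    and I: "is_stochastic_integral T \<nu> P N p I"
    and B: "B \<in> sets borel"
    and F: "F \<in> Lp p' P"
    and DF: "(\<lambda>z. indicator B (snd z) *\<^sub>R diff_op T P N F z) \<in> Lp p' (full_space T \<nu> P)"
begin

abbreviation "M \<equiv> full_space T \<nu> P"
abbreviation "Pr \<equiv> pred_space T \<nu> P N"

abbreviation DF\<^sub>B :: "('w \<times> real) \<times> 'u \<Rightarrow> 'h" where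
  "DF\<^sub>B \<equiv> \<lambda>z. indicator B (snd z) *\<^sub>R diff_op T P N F z"

text \<open>The identity to be proved, with the right-hand side as one integral over the product space.
  Cutting the difference operator down to \<open>B\<close> makes that side an \<open>L\<^sup>p\<close>-continuous functional of
  \<open>\<Phi>\<close>; for integrands that vanish off \<open>B\<close> this changes nothing.\<close>

definition dual :: "(('w \<times> real) \<times> 'u \<Rightarrow> 'h) \<Rightarrow> bool" where
  "dual \<Phi> \<longleftrightarrow> \<Phi> \<in> Lp (ennreal p) Pr \<and>
    (LINT \<omega>|P. F \<omega> \<bullet> I \<Phi> \<omega>) = (LINT z|M. DF\<^sub>B z \<bullet> \<Phi> z)"

lemma p0: "0 \<le> p" "0 < p" using p by auto

lemmas I_unfolded = I[unfolded is_stochastic_integral_def]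

lemma I_Lp: "\<Phi> \<in> Lp (ennreal p) Pr \<Longrightarrow> I \<Phi> \<in> Lp (ennreal p) P"
  by (rule I_unfolded[THEN conjunct1, THEN bspec])

lemma I_add: "\<Phi> \<in> Lp (ennreal p) Pr \<Longrightarrow> \<Psi> \<in> Lp (ennreal p) Pr \<Longrightarrow>
    AE \<omega> in P. I (\<lambda>z. \<Phi> z + \<Psi> z) \<omega> = I \<Phi> \<omega> + I \<Psi> \<omega>"
  by (rule I_unfolded[THEN conjunct2, THEN conjunct1, THEN bspec, THEN bspec])

lemma I_scaleR:
  "\<Phi> \<in> Lp (ennreal p) Pr \<Longrightarrow> AE \<omega> in P. I (\<lambda>z. c *\<^sub>R \<Phi> z) \<omega> = c *\<^sub>R I \<Phi> \<omega>"
  by (rule I_unfolded[THEN conjunct2, THEN conjunct2, THEN conjunct1, THEN spec, THEN bspec])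

lemmas I_bound = I_unfolded[THEN conjunct2, THEN conjunct2, THEN conjunct2, THEN conjunct1]

lemmas I_elementary =
  I_unfolded[THEN conjunct2, THEN conjunct2, THEN conjunct2, THEN conjunct2, rule_format]

lemma sets_Pr: "sets Pr = sets (predictable T P N \<Otimes>\<^sub>M borel)"
  unfolding pred_space_def by (rule sets_restr_to_subalg[OF subalgebra_predictable])

lemma space_Pr: "space Pr = space M"
  unfolding pred_space_def by (rule space_restr_to_subalg)

lemma sets_Pr_M: "A \<in> sets Pr \<Longrightarrow> A \<in> sets M"
  using subalgebra_predictable by (auto simp: sets_Pr subalgebra_def)

lemma measurable_Pr_iff: "f \<in> borel_measurable Pr \<longleftrightarrow> f \<in> borel_measurable (predictable T P N \<Otimes>\<^sub>M borel)"
  by (simp only: measurable_cong_sets[OF sets_Pr refl])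

lemma measurable_Pr_M: "f \<in> borel_measurable Pr \<Longrightarrow> f \<in> borel_measurable M"
  unfolding measurable_Pr_iff by (rule measurable_from_subalg[OF subalgebra_predictable])

text \<open>\<open>Pr\<close> is the restriction of the product measure to a smaller \<open>\<sigma>\<close>-algebra, so all estimates can
  be made on the product space as soon as predictability is known.\<close>

lemma Lp_Pr_iff:
  fixes \<Phi> :: "('w \<times> real) \<times> 'u \<Rightarrow> 'h"
  assumes "\<Phi> \<in> borel_measurable Pr"
  shows "\<Phi> \<in> Lp (ennreal p) Pr \<longleftrightarrow> \<Phi> \<in> Lp (ennreal p) M"
proof -
  have \<Phi>: "(\<lambda>z. norm (\<Phi> z) powr p) \<in> borel_measurable (predictable T P N \<Otimes>\<^sub>M borel)"
    using assms by (simp add: measurable_Pr_iff)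
  have "integrable Pr (\<lambda>z. norm (\<Phi> z) powr p) \<longleftrightarrow> integrable M (\<lambda>z. norm (\<Phi> z) powr p)"
    unfolding pred_space_def
    using integrable_from_subalg[OF subalgebra_predictable] integrable_in_subalg[OF subalgebra_predictable \<Phi>]
    by blast
  then show ?thesis
    using assms measurable_Pr_M[OF assms] by (simp add: Lp_iff_integrable p0)
qed

lemma Lp_Pr_M: "\<Phi> \<in> Lp (ennreal p) Pr \<Longrightarrow> (\<Phi> :: _ \<Rightarrow> 'h) \<in> Lp (ennreal p) M"
  using Lp_Pr_iff[of \<Phi>] by (auto simp: Lp_def)

lemma Lp_norm_Pr:
  fixes \<Phi> :: "('w \<times> real) \<times> 'u \<Rightarrow> 'h"
  assumes "\<Phi> \<in> borel_measurable Pr"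
  shows "Lp_norm p Pr \<Phi> = Lp_norm p M \<Phi>"
proof -
  have "(\<lambda>z. norm (\<Phi> z) powr p) \<in> borel_measurable (predictable T P N \<Otimes>\<^sub>M borel)"
    using assms by (simp add: measurable_Pr_iff)
  then show ?thesis
    unfolding Lp_norm_def pred_space_def by (simp add: integral_subalgebra2[OF subalgebra_predictable])
qed

lemmas pairing_P = Lp_pairing_bounded[OF p conj_exp F]

lemmas pairing_M = Lp_pairing_bounded[OF p conj_exp DF]

lemma integrable_F: "g \<in> Lp (ennreal p) P \<Longrightarrow> integrable P (\<lambda>\<omega>. F \<omega> \<bullet> g \<omega>)"
  using pairing_P by blast

lemma integrable_DF: "g \<in> Lp (ennreal p) M \<Longrightarrow> integrable M (\<lambda>z. DF\<^sub>B z \<bullet> g z)"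
  using pairing_M by blast

lemma F_measurable [measurable]: "F \<in> borel_measurable P"
  using F by (simp add: Lp_def)

lemma DF_measurable [measurable]: "DF\<^sub>B \<in> borel_measurable M"
  using DF by (simp add: Lp_def)

lemma I_measurable: "\<Phi> \<in> Lp (ennreal p) Pr \<Longrightarrow> I \<Phi> \<in> borel_measurable P"
  using I_Lp by (simp add: Lp_def)

lemma Lp_measurable: "\<Phi> \<in> Lp (ennreal p) Q \<Longrightarrow> \<Phi> \<in> borel_measurable Q"
  by (simp add: Lp_def)

lemma integral_F_I_add:
  assumes "\<Phi> \<in> Lp (ennreal p) Pr" "\<Psi> \<in> Lp (ennreal p) Pr"
  shows "(LINT \<omega>|P. F \<omega> \<bullet> I (\<lambda>z. \<Phi> z + \<Psi> z) \<omega>) =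
    (LINT \<omega>|P. F \<omega> \<bullet> I \<Phi> \<omega>) + (LINT \<omega>|P. F \<omega> \<bullet> I \<Psi> \<omega>)"
proof -
  note [measurable] = assms[THEN I_measurable] Lp_add[OF p0(1) assms, THEN I_measurable]
  have "(LINT \<omega>|P. F \<omega> \<bullet> I (\<lambda>z. \<Phi> z + \<Psi> z) \<omega>) = (LINT \<omega>|P. F \<omega> \<bullet> I \<Phi> \<omega> + F \<omega> \<bullet> I \<Psi> \<omega>)"
  proof (rule integral_cong_AE)
    show "AE \<omega> in P. F \<omega> \<bullet> I (\<lambda>z. \<Phi> z + \<Psi> z) \<omega> = F \<omega> \<bullet> I \<Phi> \<omega> + F \<omega> \<bullet> I \<Psi> \<omega>"
      using I_add[OF assms] by eventually_elim (simp add: inner_add_right)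
  qed measurable
  also have "\<dots> = (LINT \<omega>|P. F \<omega> \<bullet> I \<Phi> \<omega>) + (LINT \<omega>|P. F \<omega> \<bullet> I \<Psi> \<omega>)"
    using assms by (intro Bochner_Integration.integral_add integrable_F I_Lp)
  finally show ?thesis .
qed

lemma integral_F_I_scaleR:
  assumes "\<Phi> \<in> Lp (ennreal p) Pr"
  shows "(LINT \<omega>|P. F \<omega> \<bullet> I (\<lambda>z. c *\<^sub>R \<Phi> z) \<omega>) = c * (LINT \<omega>|P. F \<omega> \<bullet> I \<Phi> \<omega>)"
proof -
  note [measurable] = assms[THEN I_measurable] Lp_scaleR[OF p0(1) assms, THEN I_measurable]
  have "(LINT \<omega>|P. F \<omega> \<bullet> I (\<lambda>z. c *\<^sub>R \<Phi> z) \<omega>) = (LINT \<omega>|P. c * (F \<omega> \<bullet> I \<Phi> \<omega>))"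
  proof (rule integral_cong_AE)
    show "AE \<omega> in P. F \<omega> \<bullet> I (\<lambda>z. c *\<^sub>R \<Phi> z) \<omega> = c * (F \<omega> \<bullet> I \<Phi> \<omega>)"
      using I_scaleR[OF assms, of c] by eventually_elim simp
  qed measurable
  then show ?thesis by simp
qed

lemma dual_add:
  assumes "dual \<Phi>" "dual \<Psi>"
  shows "dual (\<lambda>z. \<Phi> z + \<Psi> z)"
proof -
  have L: "\<Phi> \<in> Lp (ennreal p) Pr" "\<Psi> \<in> Lp (ennreal p) Pr" using assms by (auto simp: dual_def)
  show ?thesis
    unfolding dual_def
    using assms integral_F_I_add[OF L] Lp_add[OF p0(1) L] integrable_DF[OF Lp_Pr_M[OF L(1)]]
      integrable_DF[OF Lp_Pr_M[OF L(2)]]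
    by (simp only: dual_def inner_add_right Bochner_Integration.integral_add simp_thms)
qed

lemma dual_scaleR:
  assumes "dual \<Phi>"
  shows "dual (\<lambda>z. c *\<^sub>R \<Phi> z)"
  using assms integral_F_I_scaleR[of \<Phi> c] Lp_scaleR[OF p0(1), of \<Phi> Pr c]
  by (simp only: dual_def inner_scaleR_right integral_mult_right_zero simp_thms)

text \<open>Both sides of the identity are bounded by a multiple of the \<open>L\<^sup>p\<close> norm of the integrand, on the
  left through the boundedness of \<open>I\<close>; domination turns pointwise into \<open>L\<^sup>p\<close> convergence.
  The differences are written \<open>d n = u n + (-1) v\<close> to match the two linearity properties of \<open>I\<close>.\<close>

lemma dual_limit:
  assumes u: "\<And>n::nat. dual (u n)" and v: "v \<in> borel_measurable Pr"
    and w: "integrable M (\<lambda>z. w z powr p)"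
    and le: "\<And>n. AE z in M. norm (u n z) \<le> w z"
    and lim: "AE z in M. (\<lambda>n. u n z) \<longlonglongrightarrow> v z"
  shows "dual v"
proof -
  have uL: "u n \<in> Lp (ennreal p) Pr" for n using u by (simp add: dual_def)
  have um: "u n \<in> borel_measurable M" for n by (rule measurable_Pr_M[OF Lp_measurable[OF uL]])
  have "v \<in> Lp (ennreal p) M"
  proof (rule Lp_dominated[OF p0(1) measurable_Pr_M[OF v] w])
    have "AE z in M. \<forall>n. norm (u n z) \<le> w z" using le by (simp add: AE_all_countable)
    with lim show "AE z in M. norm (v z) \<le> w z"
      by eventually_elim (rule tendsto_upperbound[OF tendsto_norm], auto)
  qed
  then have vL: "v \<in> Lp (ennreal p) Pr" using Lp_Pr_iff[OF v] by simp
  have neg: "(\<lambda>z. (-1) *\<^sub>R v z) \<in> Lp (ennreal p) Pr" by (rule Lp_scaleR[OF p0(1) vL])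
  define d where "d n = (\<lambda>z. u n z + (-1) *\<^sub>R v z)" for n
  have dL: "d n \<in> Lp (ennreal p) Pr" for n unfolding d_def by (rule Lp_add[OF p0(1) uL neg])
  have d0: "(\<lambda>n. Lp_norm p M (d n)) \<longlonglongrightarrow> 0"
    using Lp_norm_dominated_tendsto[OF p0(2) um measurable_Pr_M[OF v] w le lim] by (simp add: d_def)
  obtain K where K: "0 \<le> K"
    "\<And>g. g \<in> Lp (ennreal p) P \<Longrightarrow> \<bar>LINT \<omega>|P. F \<omega> \<bullet> g \<omega>\<bar> \<le> K * Lp_norm p P g"
    using pairing_P by blast
  obtain K' where K': "\<And>g. g \<in> Lp (ennreal p) M \<Longrightarrow> \<bar>LINT z|M. DF\<^sub>B z \<bullet> g z\<bar> \<le> K' * Lp_norm p M g"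
    using pairing_M by blast
  obtain C where C: "\<And>\<Phi>. \<Phi> \<in> Lp (ennreal p) Pr \<Longrightarrow> Lp_norm p P (I \<Phi>) \<le> C * Lp_norm p Pr \<Phi>"
    using I_bound by blast
  have l_eq: "(LINT \<omega>|P. F \<omega> \<bullet> I (d n) \<omega>) = (LINT \<omega>|P. F \<omega> \<bullet> I (u n) \<omega>) - (LINT \<omega>|P. F \<omega> \<bullet> I v \<omega>)" for n
    unfolding d_def integral_F_I_add[OF uL neg] integral_F_I_scaleR[OF vL] by simp
  have "(\<lambda>n. LINT \<omega>|P. F \<omega> \<bullet> I (d n) \<omega>) \<longlonglongrightarrow> 0"
  proof (rule tendsto_0_le[OF _ always_eventually, where K = 1])
    show "(\<lambda>n. K * (C * Lp_norm p M (d n))) \<longlonglongrightarrow> 0"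
      using d0 by (auto intro!: tendsto_eq_intros)
    show "\<forall>n. norm (LINT \<omega>|P. F \<omega> \<bullet> I (d n) \<omega>) \<le> norm (K * (C * Lp_norm p M (d n))) * 1"
    proof
      fix n
      have "\<bar>LINT \<omega>|P. F \<omega> \<bullet> I (d n) \<omega>\<bar> \<le> K * Lp_norm p P (I (d n))"
        by (rule K(2)[OF I_Lp[OF dL]])
      also have "\<dots> \<le> K * (C * Lp_norm p M (d n))"
        using C[OF dL, of n] K(1) by (simp add: mult_left_mono Lp_norm_Pr[OF Lp_measurable[OF dL]])
      finally show "norm (LINT \<omega>|P. F \<omega> \<bullet> I (d n) \<omega>) \<le> norm (K * (C * Lp_norm p M (d n))) * 1" by simp
    qed
  qed
  then have L1: "(\<lambda>n. LINT \<omega>|P. F \<omega> \<bullet> I (u n) \<omega>) \<longlonglongrightarrow> (LINT \<omega>|P. F \<omega> \<bullet> I v \<omega>)"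
    unfolding l_eq by (rule LIM_zero_cancel)
  have r_eq: "(LINT z|M. DF\<^sub>B z \<bullet> d n z) = (LINT z|M. DF\<^sub>B z \<bullet> u n z) - (LINT z|M. DF\<^sub>B z \<bullet> v z)" for n
  proof -
    have "(LINT z|M. DF\<^sub>B z \<bullet> d n z) = (LINT z|M. DF\<^sub>B z \<bullet> u n z - DF\<^sub>B z \<bullet> v z)"
      by (simp add: d_def inner_diff_right)
    also have "\<dots> = (LINT z|M. DF\<^sub>B z \<bullet> u n z) - (LINT z|M. DF\<^sub>B z \<bullet> v z)"
      by (intro Bochner_Integration.integral_diff integrable_DF Lp_Pr_M uL vL)
    finally show ?thesis .
  qed
  have "(\<lambda>n. LINT z|M. DF\<^sub>B z \<bullet> d n z) \<longlonglongrightarrow> 0"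
  proof (rule tendsto_0_le[OF _ always_eventually, where K = 1])
    show "(\<lambda>n. K' * Lp_norm p M (d n)) \<longlonglongrightarrow> 0"
      using d0 by (auto intro!: tendsto_eq_intros)
    show "\<forall>n. norm (LINT z|M. DF\<^sub>B z \<bullet> d n z) \<le> norm (K' * Lp_norm p M (d n)) * 1"
    proof
      fix n
      have "\<bar>LINT z|M. DF\<^sub>B z \<bullet> d n z\<bar> \<le> K' * Lp_norm p M (d n)" by (rule K'[OF Lp_Pr_M[OF dL]])
      then show "norm (LINT z|M. DF\<^sub>B z \<bullet> d n z) \<le> norm (K' * Lp_norm p M (d n)) * 1" by simp
    qed
  qed
  then have L2: "(\<lambda>n. LINT z|M. DF\<^sub>B z \<bullet> u n z) \<longlonglongrightarrow> (LINT z|M. DF\<^sub>B z \<bullet> v z)"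
    unfolding r_eq by (rule LIM_zero_cancel)
  have "(LINT \<omega>|P. F \<omega> \<bullet> I (u n) \<omega>) = (LINT z|M. DF\<^sub>B z \<bullet> u n z)" for n using u by (simp add: dual_def)
  with L1 L2 have "(LINT \<omega>|P. F \<omega> \<bullet> I v \<omega>) = (LINT z|M. DF\<^sub>B z \<bullet> v z)"
    using LIMSEQ_unique by simp
  with vL show ?thesis by (simp add: dual_def)
qed

lemma dual_cong_AE:
  assumes "dual u" "v \<in> borel_measurable Pr" "AE z in M. v z = u z"
  shows "dual v"
proof (rule dual_limit[where u = "\<lambda>_. u" and w = "\<lambda>z. norm (u z)"])
  have "u \<in> Lp (ennreal p) M" using assms(1) Lp_Pr_M by (simp add: dual_def)
  then show "integrable M (\<lambda>z. norm (u z) powr p)" by (simp add: Lp_iff_integrable p0)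
  show "AE z in M. (\<lambda>n. u z) \<longlonglongrightarrow> v z" using assms(3) by eventually_elim simp
qed (use assms in auto)

lemma dual_zero: "dual (\<lambda>_. 0)"
proof -
  have L: "(\<lambda>_. 0 :: 'h) \<in> Lp (ennreal p) Pr" by (simp add: Lp_iff_integrable p0)
  show ?thesis using L integral_F_I_scaleR[OF L, of 0] by (simp add: dual_def)
qed

lemma dual_sum:
  assumes "finite J" "\<And>j. j \<in> J \<Longrightarrow> dual (u j)"
  shows "dual (\<lambda>z. \<Sum>j\<in>J. u j z)"
  using assms by (induction J rule: finite_induct) (auto intro: dual_zero dual_add)

section \<open>From rectangles to all predictable integrands\<close>

text \<open>The event \<open>A\<close> is required to belong both to the history at \<open>u\<close>, so that adding a point after \<open>u\<close>
  leaves \<open>A\<close> unchanged, and also to the filtration at \<open>u\<close>, so that the integrand is an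
  elementary one. As \<open>b \<subseteq> B\<close>, the difference of \<open>\<langle>F, h\<rangle>\<close> is integrable over the rectangle.\<close>

lemma dual_rectangle_history:
  assumes A: "A \<in> sets (history T P N u)" "A \<in> sets (filtr T P N u)"
    and us: "0 \<le> u" "u < s" "s \<le> T" and b: "b \<in> sets borel" "emeasure \<nu> b < \<infinity>" "b \<subseteq> B"
  shows "dual (\<lambda>z. indicator ((A \<times> {u<..s}) \<times> b) z *\<^sub>R h)"
proof -
  let ?E = "(A \<times> {u<..s}) \<times> b" and ?C = "{u<..s} \<times> b"
  let ?\<Phi> = "\<lambda>z. indicator ?E z *\<^sub>R h"
  let ?S = "\<lambda>z. add_dirac (N (fst (fst z))) (snd (fst z), snd z)"
  define f where "f \<eta> = representative T P N F \<eta> \<bullet> h" for \<eta>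
  have [measurable]: "representative T P N F \<in> borel_measurable (point_measures T)"
    by (rule representative) measurable
  have f [measurable]: "f \<in> borel_measurable (point_measures T)" unfolding f_def by measurable
  have [measurable]: "A \<in> sets P" by (rule sets_filtr_P[OF A(2)])
  have C [measurable]: "?C \<in> sets (mark_space T)" and C_fin: "emeasure (leb T \<Otimes>\<^sub>M \<nu>) ?C < \<infinity>"
    using rectangle_mark[OF us(1) us(3) b(1,2)] by simp_all
  have [measurable]: "(\<lambda>\<omega>. compensated T \<nu> N ?C \<omega>) \<in> borel_measurable P"
    unfolding compensated_def measure_def by measurable
  have AE_f: "AE \<omega> in P. f (N \<omega>) = F \<omega> \<bullet> h"
    using representative(2)[OF F_measurable] by eventually_elim (simp add: f_def)

  have "A \<times> {u<..s} \<in> sets (predictable T P N)"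
    unfolding sets_predictable by (rule sigma_sets.Basic) (use A us in blast)
  then have E: "?E \<in> sets Pr" unfolding sets_Pr using b(1) by (rule pair_measureI)
  have E_fin: "emeasure M ?E < \<infinity>"
  proof -
    have "?E \<subseteq> (space P \<times> {0..T}) \<times> b" using filtr_subset_space[OF A(2)] us by auto
    from emeasure_mono[OF this emeasure_full_slab(1)[OF b(1,2)]] emeasure_full_slab(2)[OF b(1,2)]
    show ?thesis by (rule order.strict_trans1)
  qed
  have \<Phi>M: "?\<Phi> \<in> Lp (ennreal p) M" by (rule Lp_indicator[OF p0(2) sets_Pr_M[OF E] E_fin])
  have \<Phi>Pr: "?\<Phi> \<in> Lp (ennreal p) Pr"
    using \<Phi>M Lp_Pr_iff[of ?\<Phi>] E by simp

  have int_f: "integrable P (\<lambda>\<omega>. f (N \<omega>))"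
  proof -
    have "(\<lambda>_. h) \<in> Lp (ennreal p) P" by (simp add: Lp_iff_integrable p0)
    from integrable_F[OF this] have "integrable P (\<lambda>\<omega>. F \<omega> \<bullet> h)" .
    then show ?thesis
      by (rule integrable_cong_AE_imp) (use AE_f in auto)
  qed
  have int_D: "integrable M (\<lambda>z. indicator ?C (snd (fst z), snd z) * (f (?S z) - f (N (fst (fst z)))))"
  proof -
    let ?E' = "(space P \<times> {u<..s}) \<times> b"
    have "?E' = (\<lambda>z. (snd (fst z), snd z)) -` ?C \<inter> space M"
      using us by (auto simp: space_full)
    then have E': "?E' \<in> sets M" using measurable_sets[OF measurable_full_mark C] by simp
    have "?E' \<subseteq> (space P \<times> {0..T}) \<times> b" using us by auto
    from emeasure_mono[OF this emeasure_full_slab(1)[OF b(1,2)]] emeasure_full_slab(2)[OF b(1,2)]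
    have "emeasure M ?E' < \<infinity>" by (rule order.strict_trans1)
    from integrable_DF[OF Lp_indicator[OF p0(2) E' this, of h]]
    show ?thesis
      by (rule Bochner_Integration.integrable_cong[THEN iffD1, OF refl, rotated])
        (use b(3) in \<open>auto simp: space_full indicator_def diff_op_eq f_def inner_diff_left\<close>)
  qed

  have "(LINT \<omega>|P. F \<omega> \<bullet> I ?\<Phi> \<omega>) =
      (LINT \<omega>|P. indicator A \<omega> * compensated T \<nu> N ?C \<omega> * f (N \<omega>))"
  proof (rule integral_cong_AE)
    have "?\<Phi> = (\<lambda>((\<omega>, t), x). indicator ?C (t, x) *\<^sub>R (indicator A \<omega> *\<^sub>R h))"
      by (auto simp: fun_eq_iff indicator_def)
    moreover have "(\<lambda>\<omega>. indicator A \<omega> *\<^sub>R h) \<in> borel_measurable (filtr T P N u)"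
      using A(2) by measurable
    moreover have "\<exists>K. \<forall>\<omega>\<in>space P. norm (indicator A \<omega> *\<^sub>R h) \<le> K"
      by (rule exI[of _ "norm h"]) (auto simp: indicator_def)
    ultimately have "AE \<omega> in P. I ?\<Phi> \<omega> = compensated T \<nu> N ?C \<omega> *\<^sub>R (indicator A \<omega> *\<^sub>R h)"
      using I_elementary[of u s "\<lambda>\<omega>. indicator A \<omega> *\<^sub>R h" b] us b by simp
    with AE_f show "AE \<omega> in P. F \<omega> \<bullet> I ?\<Phi> \<omega> = indicator A \<omega> * compensated T \<nu> N ?C \<omega> * f (N \<omega>)"
      by eventually_elim simp
    show "(\<lambda>\<omega>. F \<omega> \<bullet> I ?\<Phi> \<omega>) \<in> borel_measurable P"
      using I_measurable[OF \<Phi>Pr] by simp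
  qed measurable
  also have "\<dots> = (LINT z|M. indicator A (fst (fst z)) * (indicator ?C (snd (fst z), snd z) *
      (f (?S z) - f (N (fst (fst z))))))"
    by (rule duality_rectangle[OF f A(1) us(1) us(3) b(1,2) int_f int_D])
  also have "\<dots> = (LINT z|M. DF\<^sub>B z \<bullet> ?\<Phi> z)"
    by (rule Bochner_Integration.integral_cong[OF refl])
      (use b(3) in \<open>auto simp: indicator_def diff_op_eq f_def inner_diff_left\<close>)
  finally show ?thesis using \<Phi>Pr by (simp add: dual_def)
qed

text \<open>Quantifying over the vector \<open>h\<close> inside the definition lets the Dynkin argument run on sets only.\<close>

definition dual_set :: "(('w \<times> real) \<times> 'u) set \<Rightarrow> bool" where
  "dual_set E \<longleftrightarrow> E \<in> sets Pr \<and> (\<forall>h. dual (\<lambda>z. indicator E z *\<^sub>R h))"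

lemma dual_set_null:
  assumes E: "E \<in> sets Pr" and "emeasure M E = 0"
  shows "dual_set E"
  unfolding dual_set_def
proof (intro conjI allI E)
  fix h :: 'h
  have "AE z in M. z \<notin> E" using assms sets_Pr_M by (intro AE_not_in) (auto intro: null_setsI)
  then have "AE z in M. indicator E z *\<^sub>R h = 0" by eventually_elim simp
  with E show "dual (\<lambda>z. indicator E z *\<^sub>R h)" by (intro dual_cong_AE[OF dual_zero]) auto
qed

lemma dual_set_Un:
  assumes "dual_set E" "dual_set E'" "E \<inter> E' = {}"
  shows "dual_set (E \<union> E')"
  unfolding dual_set_def
proof (intro conjI allI)
  show "E \<union> E' \<in> sets Pr" using assms by (auto simp: dual_set_def)
  fix h :: 'h
  have "dual (\<lambda>z. indicator E z *\<^sub>R h + indicator E' z *\<^sub>R h)"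
    using assms by (intro dual_add) (auto simp: dual_set_def)
  moreover have "(\<lambda>z. indicator E z *\<^sub>R h + indicator E' z *\<^sub>R h) = (\<lambda>z. indicator (E \<union> E') z *\<^sub>R h)"
    using assms(3) by (auto simp: fun_eq_iff indicator_def)
  ultimately show "dual (\<lambda>z. indicator (E \<union> E') z *\<^sub>R h)" by simp
qed

lemma dual_set_Diff:
  assumes "dual_set E" "dual_set E'" "E' \<subseteq> E"
  shows "dual_set (E - E')"
  unfolding dual_set_def
proof (intro conjI allI)
  show "E - E' \<in> sets Pr" using assms by (auto simp: dual_set_def)
  fix h :: 'h
  have "dual (\<lambda>z. indicator E z *\<^sub>R h + (-1) *\<^sub>R (indicator E' z *\<^sub>R h))"
    using assms by (intro dual_add dual_scaleR) (auto simp: dual_set_def)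
  moreover have "(\<lambda>z. indicator E z *\<^sub>R h + (-1) *\<^sub>R (indicator E' z *\<^sub>R h)) =
      (\<lambda>z. indicator (E - E') z *\<^sub>R h)"
    using assms(3) by (auto simp: fun_eq_iff indicator_def)
  ultimately show "dual (\<lambda>z. indicator (E - E') z *\<^sub>R h)" by simp
qed

lemma dual_set_limit:
  fixes E :: "nat \<Rightarrow> (('w \<times> real) \<times> 'u) set"
  assumes E: "\<And>n. dual_set (E n)" and E': "E' \<in> sets Pr"
    and Z: "Z \<in> sets M" "emeasure M Z < \<infinity>" "\<And>n. E n \<subseteq> Z"
    and lim: "\<And>z. (\<lambda>n. indicator (E n) z :: real) \<longlonglongrightarrow> indicator E' z"
  shows "dual_set E'"
  unfolding dual_set_def
proof (intro conjI allI E')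
  fix h :: 'h
  show "dual (\<lambda>z. indicator E' z *\<^sub>R h)"
  proof (rule dual_limit)
    show "dual (\<lambda>z. indicator (E n) z *\<^sub>R h)" for n using E by (simp add: dual_set_def)
    show "integrable M (\<lambda>z. norm (indicator Z z *\<^sub>R h) powr p)"
      using Lp_indicator[OF p0(2) Z(1,2), of h] by (simp add: Lp_iff_integrable p0)
    show "AE z in M. norm (indicator (E n) z *\<^sub>R h) \<le> norm (indicator Z z *\<^sub>R h)" for n
      using Z(3)[of n] by (auto simp: indicator_def)
    show "AE z in M. (\<lambda>n. indicator (E n) z *\<^sub>R h) \<longlonglongrightarrow> indicator E' z *\<^sub>R h"
      by (intro AE_I2 tendsto_scaleR lim tendsto_const)
    show "(\<lambda>z. indicator E' z *\<^sub>R h) \<in> borel_measurable Pr" using E' by simp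
  qed
qed

lemma dual_set_UN:
  fixes E :: "nat \<Rightarrow> (('w \<times> real) \<times> 'u) set"
  assumes E: "\<And>n. dual_set (E n)" and disj: "disjoint_family E"
    and Z: "Z \<in> sets M" "emeasure M Z < \<infinity>" "\<And>n. E n \<subseteq> Z"
  shows "dual_set (\<Union>n. E n)"
proof (rule dual_set_limit[where E = "\<lambda>n. \<Union>i<n. E i" and Z = Z])
  show "dual_set (\<Union>i<n. E i)" for n
  proof (induction n)
    case 0
    show ?case by (simp add: dual_set_null)
  next
    case (Suc n)
    have "(\<Union>i<n. E i) \<inter> E n = {}"
    proof (rule equals0I)
      fix z assume "z \<in> (\<Union>i<n. E i) \<inter> E n"
      then obtain i where "i < n" "z \<in> E i \<inter> E n" by blast
      then show False using disjoint_family_onD[OF disj, of i n] by simp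
    qed
    from dual_set_Un[OF Suc.IH E this] show ?case by (simp add: lessThan_Suc Un_commute)
  qed
  show "(\<Union>n. E n) \<in> sets Pr" using E by (auto simp: dual_set_def)
  show "(\<lambda>n. indicator (\<Union>i<n. E i) z :: real) \<longlonglongrightarrow> indicator (\<Union>n. E n) z" for z
    by (rule LIMSEQ_indicator_UN)
qed (use Z in auto)

text \<open>An event of the right-continuous filtration at \<open>r\<close> lies in the history at every \<open>u > r\<close>, though
  perhaps not at \<open>r\<close>. The rectangles over \<open>(u,s]\<close> exhaust the one over \<open>(r,s]\<close> as \<open>u\<close> decreases
  to \<open>r\<close>, all inside one slab of finite measure.\<close>

lemma dual_set_rectangle:
  assumes A: "A \<in> sets (filtr T P N r)" and rs: "0 \<le> r" "r < s" "s \<le> T"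
    and b: "b \<in> sets borel" "emeasure \<nu> b < \<infinity>" "b \<subseteq> B"
  shows "dual_set ((A \<times> {r<..s}) \<times> b)"
proof -
  \<comment> \<open>The offset 2 keeps every \<open>u n\<close> strictly below \<open>s\<close>.\<close>
  define u where "u n = r + (s - r) / (real n + 2)" for n
  have u: "r < u n" "u n < s" for n
  proof -
    show "r < u n" using rs by (simp add: u_def)
    have "(s - r) * 1 < (s - r) * (real n + 2)" using rs by (intro mult_strict_left_mono) auto
    then have "(s - r) / (real n + 2) < s - r" by (simp add: divide_less_eq)
    then show "u n < s" by (simp add: u_def)
  qed
  have sets: "(A \<times> {v<..s}) \<times> b \<in> sets Pr" if "r \<le> v" "v < s" for v
  proof -
    have "A \<in> sets (filtr T P N v)" using A that(1) by (rule sets_filtr_mono)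
    then have "A \<times> {v<..s} \<in> sets (predictable T P N)"
      unfolding sets_predictable
      by (intro sigma_sets.Basic UnI1 CollectI exI[of _ A] exI[of _ v] exI[of _ s])
        (use that rs in simp)
    then show ?thesis unfolding sets_Pr using b(1) by (rule pair_measureI)
  qed
  have u_lim: "u \<longlonglongrightarrow> r" unfolding u_def by real_asymp
  show ?thesis
  proof (rule dual_set_limit[where E = "\<lambda>n. (A \<times> {u n<..s}) \<times> b", OF _ _ emeasure_full_slab[OF b(1,2)]])
    fix n
    have "A \<in> sets (history T P N (u n))"
      using A u[of n] rs by (subst (asm) sets_filtr_iff) auto
    moreover have "A \<in> sets (filtr T P N (u n))"
      using u[of n] by (intro sets_filtr_mono[OF A]) simp
    ultimately show "dual_set ((A \<times> {u n<..s}) \<times> b)"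
      unfolding dual_set_def using u[of n] rs b
      by (intro conjI allI dual_rectangle_history sets) auto
    show "(A \<times> {u n<..s}) \<times> b \<subseteq> (space P \<times> {0..T}) \<times> b"
      using filtr_subset_space[OF A] u[of n] rs by auto
  next
    show "(A \<times> {r<..s}) \<times> b \<in> sets Pr" using rs by (intro sets) auto
  next
    fix z :: "('w \<times> real) \<times> 'u"
    obtain \<omega> t x where z: "z = ((\<omega>, t), x)" by (metis prod.collapse)
    show "(\<lambda>n. indicator ((A \<times> {u n<..s}) \<times> b) z :: real) \<longlonglongrightarrow> indicator ((A \<times> {r<..s}) \<times> b) z"
    proof (rule tendsto_eventually, cases "r < t")
      case True
      show "\<forall>\<^sub>F n in sequentially. (indicator ((A \<times> {u n<..s}) \<times> b) z :: real) =
          indicator ((A \<times> {r<..s}) \<times> b) z"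
        using order_tendstoD(2)[OF u_lim True] by eventually_elim (use True in \<open>simp add: z indicator_def\<close>)
    next
      case False
      have "\<not> u n < t" for n using False u(1)[of n] by linarith
      with False show "\<forall>\<^sub>F n in sequentially. (indicator ((A \<times> {u n<..s}) \<times> b) z :: real) =
          indicator ((A \<times> {r<..s}) \<times> b) z"
        by (simp add: z indicator_def)
    qed
  qed
qed

text \<open>Time zero is not covered by the half-open rectangles of the elementary integrands, but it is a
  null set of the product measure.\<close>

lemma dual_set_zero_slice:
  assumes "A \<in> sets (filtr T P N 0)" "b \<in> sets borel"
  shows "dual_set ((A \<times> {0}) \<times> b)"
proof (rule dual_set_null)
  have "A \<times> {0} \<in> sets (predictable T P N)"
    unfolding sets_predictable by (rule sigma_sets.Basic) (use assms in blast)
  then show "(A \<times> {0}) \<times> b \<in> sets Pr" unfolding sets_Pr using assms(2) by (rule pair_measureI)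
  have A: "A \<in> sets P" by (rule sets_filtr_P[OF assms(1)])
  have 0: "{0} \<in> sets (leb T)" using T_pos by (auto simp: leb_def sets_restrict_space_iff)
  have "emeasure (leb T) {0} = 0"
    using T_pos by (simp add: leb_def emeasure_restrict_space)
  then have "emeasure (P \<Otimes>\<^sub>M leb T) (A \<times> {0}) = 0"
    by (simp add: leb.emeasure_pair_measure_Times[OF A 0])
  then show "emeasure M ((A \<times> {0}) \<times> b) = 0"
    unfolding full_space_def using A 0 assms(2) sets_nu
    by (subst nu.emeasure_pair_measure_Times) auto
qed

lemma dual_set_slab:
  assumes b: "b \<in> sets borel" "emeasure \<nu> b < \<infinity>" "b \<subseteq> B"
  shows "dual_set ((space P \<times> {0..T}) \<times> b)"
proof -
  have P0: "space P \<in> sets (filtr T P N 0)"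
  proof -
    have sp: "space (filtr T P N 0) = space P" using subalgebra_filtr[of 0] by (simp add: subalgebra_def)
    show ?thesis using sets.top[of "filtr T P N 0"] unfolding sp .
  qed
  have "dual_set ((space P \<times> {0<..T}) \<times> b \<union> (space P \<times> {0}) \<times> b)"
    using T_pos by (intro dual_set_Un dual_set_rectangle dual_set_zero_slice P0 b) auto
  also have "(space P \<times> {0<..T}) \<times> b \<union> (space P \<times> {0}) \<times> b = (space P \<times> {0..T}) \<times> b"
    using T_pos by auto
  finally show ?thesis .
qed

text \<open>Passing from the generator to \<open>\<P>\<^sub>T \<otimes> \<B>(U)\<close> takes two Dynkin arguments: one in the predictable
  factor with a fixed set of marks, and one over products. All sets stay inside a slab of finite
  measure, which supplies the dominating function for disjoint unions.\<close>

lemma dual_set_predictable_times: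
  assumes R: "R \<in> sets (predictable T P N)" and b: "b \<in> sets borel" "emeasure \<nu> b < \<infinity>" "b \<subseteq> B"
  shows "dual_set (R \<times> b)"
  using Int_stable_pred_rectangles pred_rectangles_subset R[unfolded sets_predictable]
proof (induction rule: sigma_sets_induct_disjoint)
  case (basic R)
  then consider
      (int) A s t where "R = A \<times> {s<..t}" "0 \<le> s" "s < t" "t \<le> T" "A \<in> sets (filtr T P N s)"
    | (zero) A where "R = A \<times> {0}" "A \<in> sets (filtr T P N 0)" by blast
  then show ?case
  proof cases
    case int
    then show ?thesis using dual_set_rectangle[OF int(5,2-4) b] by simp
  next
    case zero
    then show ?thesis using dual_set_zero_slice[OF zero(2) b(1)] by simp
  qed
next
  case empty
  show ?case by (simp add: dual_set_null)
next
  case (compl R)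
  have "R \<subseteq> space P \<times> {0..T}"
    using sigma_sets_into_sp[OF pred_rectangles_subset compl(1)] .
  then have "dual_set ((space P \<times> {0..T}) \<times> b - R \<times> b)"
    by (intro dual_set_Diff dual_set_slab b compl(2)) auto
  also have "(space P \<times> {0..T}) \<times> b - R \<times> b = (space P \<times> {0..T} - R) \<times> b" by auto
  finally show ?case .
next
  case (union R)
  have "R n \<subseteq> space P \<times> {0..T}" for n
    using sigma_sets_into_sp[OF pred_rectangles_subset] union(2) by blast
  then have "dual_set (\<Union>n. R n \<times> b)"
    by (intro dual_set_UN[OF union(3) _ emeasure_full_slab[OF b(1,2)]])
      (use union(1) in \<open>unfold disjoint_family_on_def, blast\<close>, blast)
  also have "(\<Union>n. R n \<times> b) = (\<Union>n. R n) \<times> b" by auto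
  finally show ?case .
qed

lemma dual_set_restrict:
  assumes E: "E \<in> sets Pr" and b: "b \<in> sets borel" "emeasure \<nu> b < \<infinity>" "b \<subseteq> B"
  shows "dual_set (E \<inter> UNIV \<times> b)"
proof -
  let ?\<Omega> = "space (predictable T P N) \<times> space (borel :: 'u measure)"
  let ?G = "{R \<times> c | R c. R \<in> sets (predictable T P N) \<and> c \<in> sets (borel :: 'u measure)}"
  have G: "?G \<subseteq> Pow ?\<Omega>" using sets.sets_into_space by fastforce
  have "E \<in> sigma_sets ?\<Omega> ?G" using E by (simp only: sets_Pr sets_pair_measure)
  from Int_stable_pair_measure_generator G this show ?thesis
  proof (induction rule: sigma_sets_induct_disjoint)
    case (basic E)
    then obtain R c where E: "E = R \<times> c" "R \<in> sets (predictable T P N)" "c \<in> sets (borel :: 'u measure)"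
      by blast
    have "emeasure \<nu> (c \<inter> b) \<le> emeasure \<nu> b" using b(1) sets_nu by (intro emeasure_mono) auto
    then have "dual_set (R \<times> (c \<inter> b))"
      using b E by (intro dual_set_predictable_times) auto
    then show ?case by (simp add: E Times_Int_Times)
  next
    case empty
    show ?case by (simp add: dual_set_null)
  next
    case (compl E)
    have "E \<subseteq> ?\<Omega>" using sigma_sets_into_sp[OF G compl(1)] .
    then have "dual_set ((space P \<times> {0..T}) \<times> b - E \<inter> UNIV \<times> b)"
      by (intro dual_set_Diff dual_set_slab b compl(2)) (auto simp: space_predictable)
    also have "(space P \<times> {0..T}) \<times> b - E \<inter> UNIV \<times> b = (?\<Omega> - E) \<inter> UNIV \<times> b"
      by (auto simp: space_predictable)
    finally show ?case .
  next
    case (union E)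
    have E: "E n \<subseteq> ?\<Omega>" for n
      using sigma_sets_into_sp[OF G] union(2) by blast
    have "E n \<inter> UNIV \<times> b \<subseteq> (space P \<times> {0..T}) \<times> b" for n
      using E[of n] by (auto simp: space_predictable)
    then have "dual_set (\<Union>n. E n \<inter> UNIV \<times> b)"
      by (intro dual_set_UN[OF union(3) _ emeasure_full_slab[OF b(1,2)]])
        (use union(1) in \<open>unfold disjoint_family_on_def, blast\<close>, blast)
    also have "(\<Union>n. E n \<inter> UNIV \<times> b) = (\<Union>n. E n) \<inter> UNIV \<times> b" by auto
    finally show ?case .
  qed
qed

lemma dual_simple_function:
  assumes s: "simple_function Pr s" and b: "b \<in> sets borel" "emeasure \<nu> b < \<infinity>" "b \<subseteq> B"
  shows "dual (\<lambda>z. indicator (UNIV \<times> b) z *\<^sub>R s z)"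
proof (rule dual_cong_AE)
  let ?L = "\<lambda>y. s -` {y} \<inter> space Pr"
  show "dual (\<lambda>z. \<Sum>y\<in>s ` space Pr. indicator (?L y \<inter> UNIV \<times> b) z *\<^sub>R y)"
    using simple_functionD[OF s] b dual_set_restrict
    by (intro dual_sum) (auto simp: dual_set_def)
  show "AE z in M. indicator (UNIV \<times> b) z *\<^sub>R s z = (\<Sum>y\<in>s ` space Pr. indicator (?L y \<inter> UNIV \<times> b) z *\<^sub>R y)"
  proof (rule AE_I2)
    fix z assume "z \<in> space M"
    then have z: "z \<in> space Pr" by (simp add: space_Pr)
    have "(\<Sum>y\<in>s ` space Pr. indicator (?L y \<inter> UNIV \<times> b) z *\<^sub>R y) =
        (\<Sum>y\<in>s ` space Pr. if y = s z then indicator (UNIV \<times> b) z *\<^sub>R y else 0)"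
      using z by (intro sum.cong) (auto simp: indicator_def)
    also have "\<dots> = indicator (UNIV \<times> b) z *\<^sub>R s z"
      using z simple_functionD(1)[OF s] by simp
    finally show "indicator (UNIV \<times> b) z *\<^sub>R s z =
        (\<Sum>y\<in>s ` space Pr. indicator (?L y \<inter> UNIV \<times> b) z *\<^sub>R y)" by simp
  qed
  have "snd \<in> Pr \<rightarrow>\<^sub>M (borel :: 'u measure)"
    using measurable_snd[of "predictable T P N" "borel :: 'u measure"]
    by (simp only: measurable_cong_sets[OF sets_Pr refl])
  then have "snd -` b \<inter> space Pr \<in> sets Pr" using b(1) by (rule measurable_sets)
  then have "(\<lambda>z. indicator (snd -` b \<inter> space Pr) z *\<^sub>R s z) \<in> borel_measurable Pr"
    using borel_measurable_simple_function[OF s] by simp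
  then show "(\<lambda>z. indicator (UNIV \<times> b) z *\<^sub>R s z) \<in> borel_measurable Pr"
    by (rule measurable_cong[THEN iffD1, rotated]) (auto simp: indicator_def)
qed

text \<open>Simple functions bounded by \<open>2 \<parallel>\<Phi>\<parallel>\<close> converge to \<open>\<Phi>\<close> pointwise. They are cut off by sets \<open>A n \<inter> B\<close>, where
  \<open>A n\<close> exhausts \<open>U\<close> by sets of finite measure; the cut-off by \<open>B\<close> disappears in the limit because
  \<open>\<Phi>\<close> vanishes off \<open>B\<close>.\<close>

lemma dual_supported:
  assumes \<Phi>: "\<Phi> \<in> Lp (ennreal p) Pr" and supp: "AE z in M. snd z \<notin> B \<longrightarrow> \<Phi> z = 0"
  shows "dual \<Phi>"
proof -
  have \<Phi>m: "\<Phi> \<in> borel_measurable Pr" by (rule Lp_measurable[OF \<Phi>])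
  obtain s where s: "\<And>i. simple_function Pr (s i)"
    and s_lim: "\<And>z. z \<in> space Pr \<Longrightarrow> (\<lambda>i. s i z) \<longlonglongrightarrow> \<Phi> z"
    and s_le: "\<And>i z. z \<in> space Pr \<Longrightarrow> dist (s i z) 0 \<le> 2 * dist (\<Phi> z) 0"
    using borel_measurable_implies_sequence_metric[OF \<Phi>m, of 0] by metis
  obtain A :: "nat \<Rightarrow> 'u set" where A: "range A \<subseteq> sets \<nu>" "(\<Union>i. A i) = space \<nu>"
      "\<And>i. emeasure \<nu> (A i) \<noteq> \<infinity>" "incseq A"
    using nu.sigma_finite_incseq by blast
  have A_sets: "A i \<in> sets \<nu>" for i using A(1) by auto
  have b: "A i \<inter> B \<in> sets borel" "emeasure \<nu> (A i \<inter> B) < \<infinity>" "A i \<inter> B \<subseteq> B" for i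
  proof -
    show "A i \<inter> B \<in> sets borel" using A_sets[of i] B by (simp add: sets_nu)
    have "emeasure \<nu> (A i \<inter> B) \<le> emeasure \<nu> (A i)" using A_sets by (intro emeasure_mono) auto
    also have "\<dots> < \<infinity>" using A(3)[of i] by (simp add: less_top[symmetric])
    finally show "emeasure \<nu> (A i \<inter> B) < \<infinity>" .
  qed auto
  show ?thesis
  proof (rule dual_limit)
    show "dual (\<lambda>z. indicator (UNIV \<times> (A n \<inter> B)) z *\<^sub>R s n z)" for n
      by (rule dual_simple_function[OF s b])
    have "integrable M (\<lambda>z. 2 powr p * norm (\<Phi> z) powr p)"
      using Lp_Pr_M[OF \<Phi>] by (simp add: Lp_iff_integrable p0)
    then show "integrable M (\<lambda>z. (2 * norm (\<Phi> z)) powr p)" by (simp add: powr_mult)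
    show "AE z in M. norm (indicator (UNIV \<times> (A n \<inter> B)) z *\<^sub>R s n z) \<le> 2 * norm (\<Phi> z)" for n
      using s_le by (intro AE_I2) (auto simp: indicator_def space_Pr)
    show "AE z in M. (\<lambda>n. indicator (UNIV \<times> (A n \<inter> B)) z *\<^sub>R s n z) \<longlonglongrightarrow> \<Phi> z"
      using supp AE_space
    proof eventually_elim
      case (elim z)
      have lim: "(\<lambda>n. s n z) \<longlonglongrightarrow> \<Phi> z" using elim by (intro s_lim) (simp add: space_Pr)
      show ?case
      proof (cases "snd z \<in> B")
        case True
        obtain k where k: "snd z \<in> A k" using A(2) space_nu by blast
        have "\<forall>\<^sub>F n in sequentially. s n z = indicator (UNIV \<times> (A n \<inter> B)) z *\<^sub>R s n z"
          using eventually_ge_at_top[of k]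
        proof eventually_elim
          case (elim n)
          then have "snd z \<in> A n" using k incseqD[OF A(4)] by blast
          with True have "z \<in> UNIV \<times> (A n \<inter> B)" by (simp add: mem_Times_iff)
          then show ?case by simp
        qed
        from lim this show ?thesis by (rule Lim_transform_eventually)
      next
        case False
        then have "z \<notin> UNIV \<times> (A n \<inter> B)" for n by (auto simp: mem_Times_iff)
        with False elim(1) show ?thesis by simp
      qed
    qed
  qed (rule \<Phi>m)
qed

lemma duality:
  assumes \<Phi>: "\<Phi> \<in> Lp (ennreal p) Pr" and supp: "AE z in M. snd z \<notin> B \<longrightarrow> \<Phi> z = 0"
  shows "(LINT \<omega>|P. F \<omega> \<bullet> I \<Phi> \<omega>) =
    (LINT \<omega>|P. LINT t|leb T. LINT x|\<nu>. diff_op T P N F ((\<omega>, t), x) \<bullet> \<Phi> ((\<omega>, t), x))"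
proof -
  have [measurable]: "representative T P N F \<in> borel_measurable (point_measures T)"
    by (rule representative) measurable
  have [measurable]: "diff_op T P N F \<in> borel_measurable M"
    unfolding diff_op_eq[abs_def] by measurable
  have [measurable]: "\<Phi> \<in> borel_measurable M" by (rule measurable_Pr_M[OF Lp_measurable[OF \<Phi>]])
  have eq: "AE z in M. DF\<^sub>B z \<bullet> \<Phi> z = diff_op T P N F z \<bullet> \<Phi> z"
    using supp by eventually_elim (auto simp: indicator_def)
  have "integrable M (\<lambda>z. diff_op T P N F z \<bullet> \<Phi> z)"
    by (rule integrable_cong_AE_imp[OF integrable_DF[OF Lp_Pr_M[OF \<Phi>]] _ eq]) measurable
  then have int: "integrable ((P \<Otimes>\<^sub>M leb T) \<Otimes>\<^sub>M \<nu>) (\<lambda>z. diff_op T P N F z \<bullet> \<Phi> z)"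
    by (simp add: full_space_def)
  have "(LINT \<omega>|P. F \<omega> \<bullet> I \<Phi> \<omega>) = (LINT z|M. DF\<^sub>B z \<bullet> \<Phi> z)"
    using dual_supported[OF assms] by (simp add: dual_def)
  also have "\<dots> = (LINT z|M. diff_op T P N F z \<bullet> \<Phi> z)"
    by (rule integral_cong_AE[OF _ _ eq]) (intro borel_measurable_inner DF_measurable, measurable)
  also have "\<dots> = (LINT y|(P \<Otimes>\<^sub>M leb T). LINT x|\<nu>. diff_op T P N F (y, x) \<bullet> \<Phi> (y, x))"
    unfolding full_space_def by (rule full.integral_fst'[OF int, symmetric])
  also have "\<dots> = (LINT \<omega>|P. LINT t|leb T. LINT x|\<nu>. diff_op T P N F ((\<omega>, t), x) \<bullet> \<Phi> ((\<omega>, t), x))"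
    by (rule P_leb.integral_fst'[OF full.integrable_fst'[OF int], symmetric])
  finally show ?thesis .
qed

end

theorem proposition4p10:
  fixes P :: "'w measure"
    and \<nu> :: "'u::{real_inner, banach, polish_space} measure"
    and T p :: real
    and p' :: ennreal
    and N :: "'w \<Rightarrow> (real \<times> 'u) measure"
    and I :: "(('w \<times> real) \<times> 'u \<Rightarrow> 'h::{real_inner, banach, polish_space}) \<Rightarrow> 'w \<Rightarrow> 'h"
    and \<Phi> :: "('w \<times> real) \<times> 'u \<Rightarrow> 'h"
    and F :: "'w \<Rightarrow> 'h"
    and B :: "'u set"
  assumes "poisson_setting P \<nu> T N"
    and "1 \<le> p" and "p \<le> 2" and "2 \<le> p'" and "1 / ennreal p + 1 / p' = 1"
    and "is_stochastic_integral T \<nu> P N p I"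
    and "\<Phi> \<in> Lp (ennreal p) (pred_space T \<nu> P N)"
    and "B \<in> sets borel"
    and "AE z in full_space T \<nu> P. snd z \<notin> B \<longrightarrow> \<Phi> z = 0"
    and "F \<in> Lp p' P"
    and "(\<lambda>z. indicator B (snd z) *\<^sub>R diff_op T P N F z) \<in> Lp p' (full_space T \<nu> P)"
  shows "(LINT \<omega>|P. F \<omega> \<bullet> I \<Phi> \<omega>) =
    (LINT \<omega>|P. LINT t|leb T. LINT x|\<nu>. diff_op T P N F ((\<omega>, t), x) \<bullet> \<Phi> ((\<omega>, t), x))"
proof -
  interpret duality_setting P \<nu> T N p p' I F B
    using assms by (intro duality_setting.intro duality_setting_axioms.intro)
  show ?thesis using assms by (intro duality)
qed

end
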